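(* Let $N=p_1\cdots p_t$ be a product of distinct primes with each $p_i\ge5$, and let $h=\frac12\gcd(p_1-1,\ldots,p_t-1,24)$. There exist integers $r_\delta$ ($\delta\mid N$) with $f(\tau)=\prod_{\delta\mid N}\eta^{r_\delta}(\delta\tau)\in M_k^!(\Gamma_1(N))$ if and only if $h\mid k$.
   Context: $\eta(\tau)=q^{1/24}\prod_{n\ge1}(1-q^n)$, $q=e^{2\pi i\tau}$. $M_k^!(\Gamma_1(N))$ is the space of weakly holomorphic modular forms of weight $k$ on $\Gamma_1(N)$: holomorphic on the upper half-plane, meromorphic at the cusps, with $f(A\tau)=(c\tau+d)^kf(\tau)$ for all $A=\begin{psmallmatrix}a&b\\c&d\end{psmallmatrix}\in\Gamma_1(N)$. *)

theory Defs
  imports "HOL-Complex_Analysis.Complex_Analysis" "HOL-Number_Theory.Cong"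
begin

definition upper_half_plane :: "complex set" where
  "upper_half_plane = {\<tau>. Im \<tau> > 0}"

text \<open>Writing \<open>q = exp (2 \<pi> \<i> \<tau>)\<close>, the factor \<open>q\<^bsup>1/24\<^esup>\<close> means \<open>exp (2 \<pi> \<i> \<tau> / 24)\<close>. The library's
  infinite product is indexed from 0, hence the \<open>Suc n\<close>.\<close>

definition dedekind_eta :: "complex \<Rightarrow> complex" where
  "dedekind_eta \<tau> = exp (2 * of_real pi * \<i> * \<tau> / 24) *
     (\<Prod>n. 1 - exp (2 * of_real pi * \<i> * \<tau>) ^ Suc n)"

text \<open>The quadruple \<open>(a, b, c, d)\<close> stands for the matrix with rows \<open>(a, b)\<close> and \<open>(c, d)\<close>.\<close>

type_synonym mat2 = "int \<times> int \<times> int \<times> int"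

definition SL2Z :: "mat2 set" where
  "SL2Z = {(a, b, c, d). a * d - b * c = 1}"

definition Gamma1 :: "nat \<Rightarrow> mat2 set" where
  "Gamma1 N = {(a, b, c, d). (a, b, c, d) \<in> SL2Z \<and>
     [a = 1] (mod int N) \<and> [d = 1] (mod int N) \<and> [c = 0] (mod int N)}"

fun moebius :: "mat2 \<Rightarrow> complex \<Rightarrow> complex" where
  "moebius (a, b, c, d) \<tau> = (of_int a * \<tau> + of_int b) / (of_int c * \<tau> + of_int d)"

fun automorphy_factor :: "mat2 \<Rightarrow> complex \<Rightarrow> complex" where
  "automorphy_factor (a, b, c, d) \<tau> = of_int c * \<tau> + of_int d"

definition slash :: "int \<Rightarrow> (complex \<Rightarrow> complex) \<Rightarrow> mat2 \<Rightarrow> complex \<Rightarrow> complex" where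
  "slash k f A \<tau> = automorphy_factor A \<tau> powi (- k) * f (moebius A \<tau>)"

text \<open>As \<open>A\<close> ranges over \<open>SL2Z\<close>, \<open>A \<infinity>\<close> ranges over all cusps. If \<open>f\<close> is invariant in weight
  \<open>k\<close> under \<open>Gamma1 N\<close>, which contains the principal congruence subgroup of level \<open>N\<close>, then
  \<open>slash k f A\<close> has period \<open>N\<close>, so it is a function \<open>g\<close> of \<open>q\<^bsub>N\<^esub> = exp (2 \<pi> \<i> \<tau> / N)\<close> on the punctured
  unit disc. Meromorphy at the cusp \<open>A \<infinity>\<close> says that \<open>g\<close> is meromorphic at \<open>q\<^bsub>N\<^esub> = 0\<close>.\<close>

definition meromorphic_at_cusps :: "int \<Rightarrow> nat \<Rightarrow> (complex \<Rightarrow> complex) \<Rightarrow> bool" where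
  "meromorphic_at_cusps k N f \<longleftrightarrow>
     (\<forall>A\<in>SL2Z. \<exists>g. g meromorphic_on {0} \<and>
        (\<forall>\<tau>\<in>upper_half_plane. slash k f A \<tau> = g (exp (2 * of_real pi * \<i> * \<tau> / of_nat N))))"

definition weakly_holomorphic_forms :: "int \<Rightarrow> nat \<Rightarrow> (complex \<Rightarrow> complex) set" where
  "weakly_holomorphic_forms k N =
     {f. f holomorphic_on upper_half_plane \<and>
         (\<forall>A\<in>Gamma1 N. \<forall>\<tau>\<in>upper_half_plane.
            f (moebius A \<tau>) = automorphy_factor A \<tau> powi k * f \<tau>) \<and>
         meromorphic_at_cusps k N f}"

definition eta_quotient :: "nat \<Rightarrow> (nat \<Rightarrow> int) \<Rightarrow> complex \<Rightarrow> complex" where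
  "eta_quotient N r \<tau> = (\<Prod>\<delta> | \<delta> dvd N. dedekind_eta (of_nat \<delta> * \<tau>) powi r \<delta>)"

end

theory Submission
  imports Defs
begin

text \<open>
  Necessity: invariance under \<open>\<tau> \<mapsto> \<tau> + 1\<close> gives \<open>24 dvd (\<Sum>\<delta>. \<delta> r\<^sub>\<delta>)\<close>, and comparing absolute values
  under the matrix with rows \<open>(1, 0)\<close> and \<open>(N, 1)\<close> gives \<open>(\<Sum>\<delta>. r\<^sub>\<delta>) = 2 k\<close>. Every divisor \<open>\<delta>\<close> of \<open>N\<close> is
  congruent to 1 modulo \<open>2 h = gcd(p\<^sub>1 - 1, \<dots>, p\<^sub>t - 1, 24)\<close>, hence \<open>2 h\<close> divides \<open>2 k\<close>.

  Sufficiency: the weights of eta quotients form a group, so it is enough to realize 12, by \<open>\<eta>\<^bsup>24\<^esup>\<close>, and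
  \<open>(p - 1) / 2\<close> for each prime \<open>p\<close> dividing \<open>N\<close>, by \<open>\<eta>(\<tau>)\<^sup>p / \<eta>(p \<tau>)\<close>. Up to a constant, the inverse of the
  latter is the product of the Klein forms with characteristics \<open>(0, a/p)\<close> for \<open>1 \<le> a \<le> (p - 1) / 2\<close>. Klein
  forms have weight -1 and are permuted by \<open>SL\<^sub>2(\<int>)\<close> without any multiplier, so on \<open>\<Gamma>\<^sub>1(p)\<close> only an explicit
  product of roots of unity from their quasi-periodicity remains, and it equals 1. The inversion formula for
  Klein forms is Liouville's theorem applied to a quotient of theta functions; the characteristics \<open>(0, 1/2)\<close>
  and \<open>(1/2, 0)\<close> then yield that of \<open>\<eta>\<^bsup>24\<^esup>\<close>. Meromorphy at the cusps follows from invariance, because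
  \<open>|\<eta>(\<tau>)|\<close> lies between \<open>exp(-C (y + 1/y))\<close> and \<open>exp(C (y + 1/y))\<close> for \<open>y = Im \<tau>\<close>.
\<close>

section \<open>Infinite products\<close>

text \<open>The q-Pochhammer symbol of infinite length. Keeping \<open>x\<close> free lets one
  function serve both the Euler product of eta (\<open>x = q\<close>) and the two products in the
  theta function.\<close>

definition qpoch :: "complex \<Rightarrow> complex \<Rightarrow> complex" where
  "qpoch x q = (\<Prod>n. 1 - x * q ^ n)"

lemma convergent_prod_qpoch:
  fixes x q :: complex
  assumes "norm q < 1"
  shows "convergent_prod (\<lambda>n. 1 - x * q ^ n)"
proof -
  have "summable (\<lambda>n. norm (- (x * q ^ n)))"
    using assms by (simp add: norm_mult norm_power summable_mult summable_geometric)
  hence "summable (\<lambda>n. norm ((1 - x * q ^ n) - 1))"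
    by simp
  thus ?thesis
    by (intro abs_convergent_prod_imp_convergent_prod summable_imp_abs_convergent_prod)
qed

text \<open>A convergent infinite product vanishes only through one of its factors. This later
  locates all zeros of the theta function.\<close>

lemma qpoch_eq_0_iff:
  assumes "norm q < 1"
  shows "qpoch x q = 0 \<longleftrightarrow> (\<exists>n. x * q ^ n = 1)"
proof -
  have "(\<lambda>n. 1 - x * q ^ n) has_prod qpoch x q"
    unfolding qpoch_def using convergent_prod_qpoch[OF assms] by (rule convergent_prod_has_prod)
  from has_prod_eq_0_iff[OF this] have "qpoch x q = 0 \<longleftrightarrow> (\<exists>n. 0 = 1 - x * q ^ n)"
    by (auto simp only: image_iff Bex_def UNIV_I simp_thms)
  also have "\<dots> \<longleftrightarrow> (\<exists>n. x * q ^ n = 1)"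
    by (intro arg_cong[of _ _ Ex] ext) (metis eq_iff_diff_eq_0)
  finally show ?thesis .
qed

lemma qpoch_nonzero:
  assumes "norm q < 1" "norm x < 1"
  shows "qpoch x q \<noteq> 0"
proof
  assume "qpoch x q = 0"
  then obtain n where "x * q ^ n = 1" using assms by (auto simp: qpoch_eq_0_iff)
  moreover have "norm (x * q ^ n) \<le> norm x * 1"
    unfolding norm_mult norm_power using assms by (intro mult_left_mono power_le_one) auto
  ultimately show False using assms by simp
qed

lemma qpoch_rec:
  assumes "norm q < 1"
  shows "qpoch x q = (1 - x) * qpoch (x * q) q"
proof -
  have "(\<lambda>n. 1 - (x * q) * q ^ n) has_prod qpoch (x * q) q"
    unfolding qpoch_def using convergent_prod_qpoch[OF assms] by (rule convergent_prod_has_prod)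
  hence "(\<lambda>n. 1 - x * q ^ Suc n) has_prod qpoch (x * q) q"
    by (simp add: mult_ac)
  from has_prod_Suc_imp[OF this] have "(\<lambda>n. 1 - x * q ^ n) has_prod (qpoch (x * q) q * (1 - x))"
    by simp
  thus ?thesis by (simp add: qpoch_def has_prod_iff mult_ac)
qed

text \<open>For \<open>y \<noteq> 0\<close> this is the factorization of X^n - 1 over the roots of
  unity, evaluated at \<open>1 / y\<close> and scaled by \<open>y ^ n\<close>.\<close>

lemma one_minus_power_eq_prod:
  fixes y :: complex
  assumes "n > 0"
  shows "(\<Prod>a<n. 1 - y * exp (2 * of_real pi * \<i> * of_nat a / of_nat n)) = 1 - y ^ n"
proof -
  define \<zeta> where "\<zeta> = (\<lambda>a::nat. exp (2 * of_real pi * \<i> * of_nat a / of_nat n))"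
  have cis: "\<zeta> a = cis (2 * pi * real a / real n)" for a
    by (simp add: \<zeta>_def cis_conv_exp mult_ac)
  have bij: "bij_betw \<zeta> {..<n} {z. z ^ n = 1}"
    using Complex.bij_betw_roots_unity[OF assms] unfolding cis[abs_def] by simp
  define P where "P = (\<Prod>a<n. [:- \<zeta> a, 1:])"
  define Q where "Q = Polynomial.monom 1 n - (1 :: complex poly)"
  have degP: "degree P = n" unfolding P_def by (subst degree_prod_eq_sum_degree) auto
  have lcP: "lead_coeff P = 1" unfolding P_def by (simp add: lead_coeff_prod)
  have PQ: "P = Q"
  proof (rule ccontr)
    \<comment> \<open>Both polynomials are monic of degree \<open>n\<close>, so the difference has
      degree below \<open>n\<close>, yet it vanishes at \<open>n\<close> distinct roots of
      unity.\<close>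
    assume ne: "P \<noteq> Q"
    have degQ: "degree Q = n" "lead_coeff Q = 1"
    proof -
      have "degree (Polynomial.monom 1 n + (-1 :: complex poly)) = degree (Polynomial.monom (1 :: complex) n)"
        using assms by (intro degree_add_eq_left) (simp add: degree_monom_eq)
      thus *: "degree Q = n" by (simp add: Q_def degree_monom_eq)
      show "lead_coeff Q = 1" using assms unfolding * by (simp add: Q_def)
    qed
    have deg: "degree (P - Q) < n"
    proof -
      have "degree (P - Q) \<le> n" using degP degQ by (metis degree_diff_le order_refl)
      moreover have "coeff (P - Q) n = 0" using degP lcP degQ by simp
      ultimately show ?thesis using ne
        by (metis le_neq_implies_less leading_coeff_0_iff right_minus_eq)
    qed
    have "poly (P - Q) (\<zeta> a) = 0" if "a < n" for a
    proof -
      have "poly P (\<zeta> a) = 0" using that by (auto simp: P_def poly_prod)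
      moreover have "\<zeta> a ^ n = 1" using bij that by (auto simp: bij_betw_def)
      ultimately show ?thesis by (simp add: Q_def poly_monom)
    qed
    hence "\<zeta> ` {..<n} \<subseteq> {z. poly (P - Q) z = 0}" by blast
    hence "card (\<zeta> ` {..<n}) \<le> card {z. poly (P - Q) z = 0}"
      using ne by (intro card_mono poly_roots_finite) auto
    also have "\<dots> \<le> degree (P - Q)" using ne by (intro card_poly_roots_bound) auto
    finally show False using deg bij card_image[of \<zeta> "{..<n}"] by (simp add: bij_betw_def)
  qed
  have eq: "(\<Prod>a<n. x - \<zeta> a) = x ^ n - 1" for x
    using arg_cong[OF PQ, of "\<lambda>p. poly p x"] by (simp add: P_def Q_def poly_prod poly_monom)
  show ?thesis
  proof (cases "y = 0")
    case False
    have "(\<Prod>a<n. 1 - y * \<zeta> a) = (\<Prod>a<n. y * (1 / y - \<zeta> a))"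
      using False by (intro prod.cong refl) (simp add: algebra_simps)
    also have "\<dots> = y ^ n * ((1 / y) ^ n - 1)" by (simp add: prod.distrib eq)
    also have "\<dots> = 1 - y ^ n" using False by (simp add: field_simps)
    finally show ?thesis by (simp add: \<zeta>_def)
  qed (use assms in auto)
qed

text \<open>The identity holds factor by factor. For \<open>x = q\<close> it collects the Euler
  product at \<open>q\<close> and its twists into the Euler product at \<open>q ^ n\<close>, the one
  that occurs in \<open>dedekind_eta (of_nat n * \<tau>)\<close>.\<close>

lemma prod_qpoch_roots_of_unity:
  assumes "norm q < 1" "n > 0"
  shows "(\<Prod>a<n. qpoch (x * exp (2 * of_real pi * \<i> * of_nat a / of_nat n)) q) = qpoch (x ^ n) (q ^ n)"
proof -
  have "(\<Prod>a<n. qpoch (x * exp (2 * of_real pi * \<i> * of_nat a / of_nat n)) q) =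
      (\<Prod>k. \<Prod>a<n. 1 - (x * exp (2 * of_real pi * \<i> * of_nat a / of_nat n)) * q ^ k)"
    unfolding qpoch_def by (intro prodinf_prod[symmetric] convergent_prod_qpoch assms)
  also have "\<dots> = (\<Prod>k. 1 - (x * q ^ k) ^ n)"
    by (intro prodinf_cong) (simp add: one_minus_power_eq_prod[OF assms(2), symmetric] mult_ac)
  finally show ?thesis
    by (simp add: qpoch_def power_mult_distrib power_mult[symmetric] mult.commute)
qed

text \<open>The partial products converge locally uniformly: on a closed disc \<open>f\<close> is
  bounded and \<open>norm (g z)\<close> attains a maximum below 1, so a geometric series
  dominates.\<close>

lemma holomorphic_on_qpoch [holomorphic_intros]:
  assumes "f holomorphic_on S" "g holomorphic_on S" "open S" "\<And>z. z \<in> S \<Longrightarrow> norm (g z) < 1"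
  shows "(\<lambda>z. qpoch (f z) (g z)) holomorphic_on S"
proof (rule holomorphic_uniform_sequence[OF \<open>open S\<close>, of "\<lambda>n z. \<Prod>k<n. 1 - f z * g z ^ k"])
  fix n show "(\<lambda>z. \<Prod>k<n. 1 - f z * g z ^ k) holomorphic_on S"
    by (intro holomorphic_intros assms)
next
  fix x assume "x \<in> S"
  then obtain d where d: "d > 0" "cball x d \<subseteq> S"
    using \<open>open S\<close> open_contains_cball by blast
  have contf: "continuous_on (cball x d) f" and contg: "continuous_on (cball x d) g"
    using assms(1,2) d(2) by (auto intro: holomorphic_on_imp_continuous_on holomorphic_on_subset)
  obtain M where M: "\<And>z. z \<in> cball x d \<Longrightarrow> norm (f z) \<le> M"
    using compact_imp_bounded[OF compact_continuous_image[OF contf compact_cball]]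
    unfolding bounded_iff by blast
  obtain w where w: "w \<in> cball x d" "\<And>z. z \<in> cball x d \<Longrightarrow> norm (g z) \<le> norm (g w)"
    using continuous_attains_sup[OF compact_cball _ continuous_on_norm[OF contg]] d by auto
  define \<rho> where "\<rho> = norm (g w)"
  have \<rho>: "\<rho> < 1" "\<rho> \<ge> 0" using assms(4) w d by (auto simp: \<rho>_def)
  have "uniformly_convergent_on (cball x d) (\<lambda>N z. \<Sum>n<N. norm ((1 - f z * g z ^ n) - 1))"
  proof (rule Weierstrass_m_test')
    show "summable (\<lambda>n. M * \<rho> ^ n)" using \<rho> by (intro summable_mult summable_geometric) auto
    fix n z assume z: "z \<in> cball x d"
    have "norm (f z) * norm (g z) ^ n \<le> M * \<rho> ^ n"
      using M[OF z] w(2)[OF z] \<rho> order_trans[OF norm_ge_zero M[OF z]]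
      by (intro mult_mono power_mono) (auto simp: \<rho>_def)
    thus "norm (norm ((1 - f z * g z ^ n) - 1)) \<le> M * \<rho> ^ n"
      by (simp add: norm_mult norm_power)
  qed
  hence "uniformly_convergent_on (cball x d) (\<lambda>N z. \<Prod>n<N. 1 - f z * g z ^ n)"
    by (intro uniformly_convergent_on_prod') (auto intro!: continuous_intros contf contg)
  \<comment> \<open>Uniform convergence yields the limit as \<open>lim\<close>; pointwise this
    agrees with the infinite product.\<close>
  hence "uniform_limit (cball x d) (\<lambda>N z. \<Prod>n<N. 1 - f z * g z ^ n) (\<lambda>z. \<Prod>n. 1 - f z * g z ^ n) sequentially"
    unfolding uniformly_convergent_uniform_limit_iff
  proof (rule uniform_limit_cong'[THEN iffD1, rotated 2])
    fix z assume "z \<in> cball x d"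
    hence "norm (g z) < 1" using d assms(4) by auto
    thus "lim (\<lambda>N. \<Prod>n<N. 1 - f z * g z ^ n) = (\<Prod>n. 1 - f z * g z ^ n)"
      by (intro limI has_prod_imp_tendsto' convergent_prod_has_prod convergent_prod_qpoch)
  qed simp
  thus "\<exists>d>0. cball x d \<subseteq> S \<and> uniform_limit (cball x d) (\<lambda>n z. \<Prod>k<n. 1 - f z * g z ^ k) (\<lambda>z. qpoch (f z) (g z)) sequentially"
    using d unfolding qpoch_def by blast
qed

section \<open>The normalized theta function\<close>

definition ee :: "complex \<Rightarrow> complex" where
  "ee z = exp (2 * of_real pi * \<i> * z)"

lemma ee_nonzero [simp]: "ee z \<noteq> 0"
  by (simp add: ee_def)

lemma ee_0 [simp]: "ee 0 = 1"
  by (simp add: ee_def)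

lemma ee_add: "ee (x + y) = ee x * ee y"
  by (simp add: ee_def exp_add ring_distribs)

lemma ee_minus: "ee (- x) = inverse (ee x)"
  by (simp add: ee_def exp_minus)

lemma ee_diff: "ee (x - y) = ee x / ee y"
  by (simp add: ee_def exp_diff ring_distribs)

lemma ee_of_nat_mult: "ee (of_nat n * x) = ee x ^ n"
  unfolding ee_def by (subst exp_of_nat_mult[symmetric]) (simp add: mult_ac)

lemma ee_of_int_mult: "ee (of_int n * x) = ee x powi n"
  unfolding ee_def by (simp add: exp_power_int mult_ac)

lemma ee_eq_1_iff: "ee z = 1 \<longleftrightarrow> (\<exists>n::int. z = of_int n)"
proof
  assume "ee z = 1"
  then obtain n :: int where n: "Re (2 * of_real pi * \<i> * z) = 0" "Im (2 * of_real pi * \<i> * z) = of_int (2 * n) * pi"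
    unfolding ee_def exp_eq_1 by blast
  hence "z = of_int n" by (simp add: complex_eq_iff)
  thus "\<exists>n::int. z = of_int n" ..
next
  assume "\<exists>n::int. z = of_int n"
  then obtain n :: int where [simp]: "z = of_int n" by blast
  show "ee z = 1" unfolding ee_def exp_eq_1 by (auto intro!: exI[of _ n])
qed

lemma ee_of_int [simp]: "ee (of_int n) = 1"
  by (auto simp: ee_eq_1_iff)

lemma ee_1 [simp]: "ee 1 = 1"
  using ee_of_int[of 1] by simp

lemma ee_half [simp]: "ee (1 / 2) = -1"
  by (simp add: ee_def exp_pi_i)

lemma norm_ee: "norm (ee z) = exp (- (2 * pi * Im z))"
  by (simp add: ee_def)

lemma norm_ee_less_1: "Im \<tau> > 0 \<Longrightarrow> norm (ee \<tau>) < 1"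
  by (simp add: norm_ee)

lemma holomorphic_on_ee [holomorphic_intros]:
  "f holomorphic_on S \<Longrightarrow> (\<lambda>z. ee (f z)) holomorphic_on S"
  unfolding ee_def by (intro holomorphic_intros)

text \<open>In terms of Jacobi's theta function, \<open>theta_ratio z \<tau> = \<theta>\<^sub>1(z | \<tau>) / \<theta>\<^sub>1'(0 | \<tau>)\<close>.\<close>

definition theta_ratio :: "complex \<Rightarrow> complex \<Rightarrow> complex" where
  "theta_ratio z \<tau> = \<i> / (2 * of_real pi) * ee (- z / 2) * qpoch (ee z) (ee \<tau>) * qpoch (ee (\<tau> - z)) (ee \<tau>)
     / qpoch (ee \<tau>) (ee \<tau>) ^ 2"

lemma theta_ratio_add_1: "theta_ratio (z + 1) \<tau> = - theta_ratio z \<tau>"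
proof -
  have "ee (- (z + 1) / 2) = - ee (- z / 2)"
    using ee_diff[of "- z / 2" "1 / 2"] by (simp add: diff_divide_distrib)
  moreover have "ee (z + 1) = ee z" "ee (\<tau> - (z + 1)) = ee (\<tau> - z)"
    by (simp_all add: ee_add ee_diff)
  ultimately show ?thesis unfolding theta_ratio_def by simp
qed

text \<open>The shift multiplies \<open>ee z\<close> by \<open>ee \<tau>\<close>, so one factor
  leaves the first product and one joins the second. These two factors and the prefactor make up the
  multiplier.\<close>

lemma theta_ratio_add_tau:
  assumes "Im \<tau> > 0"
  shows "theta_ratio (z + \<tau>) \<tau> = - ee (- \<tau> / 2 - z) * theta_ratio z \<tau>"
proof -
  note q = norm_ee_less_1[OF assms]
  have 1: "qpoch (ee z) (ee \<tau>) = (1 - ee z) * qpoch (ee (z + \<tau>)) (ee \<tau>)"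
    using qpoch_rec[OF q, of "ee z"] by (simp add: ee_add)
  have 2: "qpoch (ee (\<tau> - (z + \<tau>))) (ee \<tau>) = (1 - ee (- z)) * qpoch (ee (\<tau> - z)) (ee \<tau>)"
    using qpoch_rec[OF q, of "ee (-z)"] by (simp add: ee_add[symmetric])
  have 3: "ee (- (z + \<tau>) / 2) * (1 - ee (- z)) = - ee (- \<tau> / 2 - z) * (ee (- z / 2) * (1 - ee z))"
    by (simp add: algebra_simps ee_add[symmetric] add_divide_distrib diff_divide_distrib)
  have "theta_ratio (z + \<tau>) \<tau> = \<i> / (2 * of_real pi) * (ee (- (z + \<tau>) / 2) * (1 - ee (- z))) *
      qpoch (ee (z + \<tau>)) (ee \<tau>) * qpoch (ee (\<tau> - z)) (ee \<tau>) / qpoch (ee \<tau>) (ee \<tau>) ^ 2"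
    unfolding theta_ratio_def 2 by simp
  also have "\<dots> = - ee (- \<tau> / 2 - z) * theta_ratio z \<tau>"
    unfolding 3 theta_ratio_def 1 by simp
  finally show ?thesis .
qed

text \<open>The reflection exchanges the two products up to their leading factors
  \<open>1 - ee z\<close> and \<open>1 - ee (- z)\<close>.\<close>

lemma theta_ratio_minus:
  assumes "Im \<tau> > 0"
  shows "theta_ratio (- z) \<tau> = - theta_ratio z \<tau>"
proof -
  note q = norm_ee_less_1[OF assms]
  have 1: "qpoch (ee (- z)) (ee \<tau>) = (1 - ee (- z)) * qpoch (ee (\<tau> - z)) (ee \<tau>)"
    using qpoch_rec[OF q, of "ee (-z)"] by (simp add: ee_add[symmetric])
  have 2: "qpoch (ee z) (ee \<tau>) = (1 - ee z) * qpoch (ee (\<tau> + z)) (ee \<tau>)"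
    using qpoch_rec[OF q, of "ee z"] by (simp add: ee_add mult_ac)
  have 3: "ee (z / 2) * (1 - ee (- z)) = - (ee (- z / 2) * (1 - ee z))"
    by (simp add: algebra_simps ee_add[symmetric])
  have "theta_ratio (- z) \<tau> = \<i> / (2 * of_real pi) * (ee (z / 2) * (1 - ee (- z))) *
      qpoch (ee (\<tau> - z)) (ee \<tau>) * qpoch (ee (\<tau> + z)) (ee \<tau>) / qpoch (ee \<tau>) (ee \<tau>) ^ 2"
    unfolding theta_ratio_def 1 by simp
  also have "\<dots> = - theta_ratio z \<tau>"
    unfolding 3 theta_ratio_def 2 by simp
  finally show ?thesis .
qed

lemma theta_ratio_eq_0_iff:
  assumes "Im \<tau> > 0"
  shows "theta_ratio z \<tau> = 0 \<longleftrightarrow> (\<exists>m n :: int. z = of_int m * \<tau> + of_int n)"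
proof -
  note q = norm_ee_less_1[OF assms]
  have eq: "theta_ratio z \<tau> = 0 \<longleftrightarrow> (\<exists>k::nat. ee (z + of_nat k * \<tau>) = 1) \<or> (\<exists>k::nat. ee (\<tau> - z + of_nat k * \<tau>) = 1)"
    using q qpoch_nonzero[OF q q] by (simp add: theta_ratio_def qpoch_eq_0_iff ee_add ee_of_nat_mult)
  show ?thesis
  proof
    assume "theta_ratio z \<tau> = 0"
    then consider k :: nat and n :: int where "z + of_nat k * \<tau> = of_int n"
      | k :: nat and n :: int where "\<tau> - z + of_nat k * \<tau> = of_int n"
      unfolding eq ee_eq_1_iff by blast
    thus "\<exists>m n :: int. z = of_int m * \<tau> + of_int n"
    proof cases
      case 1
      hence "z = of_int (- int k) * \<tau> + of_int n" by (simp add: algebra_simps)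
      thus ?thesis by blast
    next
      case 2
      hence "z = of_int (int k + 1) * \<tau> + of_int (- n)" by (simp add: algebra_simps)
      thus ?thesis by blast
    qed
  next
    assume "\<exists>m n :: int. z = of_int m * \<tau> + of_int n"
    then obtain m n :: int where z: "z = of_int m * \<tau> + of_int n" by blast
    show "theta_ratio z \<tau> = 0"
    \<comment> \<open>The first product vanishes at the lattice points with
      \<open>m \<le> 0\<close>, the second at those with \<open>m \<ge> 1\<close>.\<close>
    proof (cases "m \<le> 0")
      case True
      hence "z + of_nat (nat (- m)) * \<tau> = of_int n" by (simp add: z)
      thus ?thesis unfolding eq ee_eq_1_iff by blast
    next
      case False
      hence "\<tau> - z + of_nat (nat (m - 1)) * \<tau> = of_int (- n)" by (simp add: z algebra_simps)
      thus ?thesis unfolding eq ee_eq_1_iff by blast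
    qed
  qed
qed

lemma holomorphic_on_theta_ratio [holomorphic_intros]:
  assumes "Im \<tau> > 0" "f holomorphic_on S" "open S"
  shows "(\<lambda>z. theta_ratio (f z) \<tau>) holomorphic_on S"
  unfolding theta_ratio_def
  using norm_ee_less_1[OF assms(1)] qpoch_nonzero[of "ee \<tau>" "ee \<tau>"]
  by (intro holomorphic_intros assms) auto

text \<open>The constant \<open>\<i> / (2 * of_real pi)\<close> in \<open>theta_ratio\<close> is
  chosen for this: it cancels the derivative of the vanishing factor \<open>1 - ee z\<close>, while
  the remaining products equal 1 at 0.\<close>

lemma has_field_derivative_theta_ratio_0:
  assumes "Im \<tau> > 0"
  shows "((\<lambda>z. theta_ratio z \<tau>) has_field_derivative 1) (at 0)"
proof -
  note q = norm_ee_less_1[OF assms]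
  note nz = qpoch_nonzero[OF q q]
  define P where "P = (\<lambda>z. qpoch (ee (z + \<tau>)) (ee \<tau>) * qpoch (ee (\<tau> - z)) (ee \<tau>) / qpoch (ee \<tau>) (ee \<tau>) ^ 2)"
  define s where "s = (\<lambda>z. \<i> / (2 * of_real pi) * ee (- z / 2) * (1 - ee z))"
  have eq: "theta_ratio z \<tau> = s z * P z" for z
    using qpoch_rec[OF q, of "ee z"] by (simp add: ee_add theta_ratio_def s_def P_def)
  have "P holomorphic_on UNIV"
    unfolding P_def using q nz by (intro holomorphic_intros) auto
  hence dP: "(P has_field_derivative deriv P 0) (at 0)"
    by (rule holomorphic_derivI) auto
  have "P 0 = 1" using nz by (simp add: P_def power2_eq_square)
  have "(s has_field_derivative 1) (at 0)"
    unfolding s_def ee_def by (auto intro!: derivative_eq_intros simp: field_simps)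
  from DERIV_mult[OF this dP] show ?thesis
    unfolding eq[abs_def] using \<open>P 0 = 1\<close> by (simp add: s_def)
qed

section \<open>Liouville's theorem for doubly periodic and quasi-periodic functions\<close>

lemma doubly_periodic_shift:
  fixes f :: "complex \<Rightarrow> 'a"
  assumes "\<And>z. f (z + 1) = f z" "\<And>z. f (z + \<tau>) = f z"
  shows "f (z + of_int m * \<tau> + of_int n) = f z"
proof -
  have period: "f (z + of_int n * w) = f z" if "\<And>z. f (z + w) = f z" for w z and n :: int
  proof (induction n rule: int_induct[of _ 0])
    case (step1 i)
    show ?case using that[of "z + of_int i * w"] step1 by (simp add: algebra_simps)
  next
    case (step2 i)
    show ?case using that[of "z + of_int (i - 1) * w"] step2 by (simp add: algebra_simps)
  qed simp
  show ?thesis using period[OF assms(1), of "z + of_int m * \<tau>" n] period[OF assms(2), of z m] by simp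
qed

text \<open>All values are already taken on a fundamental parallelogram, which lies in a compact
  disc, so Liouville's theorem applies.\<close>

lemma doubly_periodic_entire_eq:
  assumes "Im \<tau> > 0" "f holomorphic_on UNIV"
    and "\<And>z. f (z + 1) = f z" "\<And>z. f (z + \<tau>) = f z"
  shows "f z = f w"
proof -
  have "f x \<in> f ` cball 0 (norm \<tau> + 1)" for x
  proof -
    \<comment> \<open>\<open>s\<close> and \<open>t\<close> are the real coordinates of
      \<open>x\<close> in the basis \<open>\<tau>\<close>, 1; their fractional parts give the
      representative \<open>y\<close>.\<close>
    define s where "s = Im x / Im \<tau>"
    define t where "t = Re x - s * Re \<tau>"
    have x: "x = of_real s * \<tau> + of_real t"
      using assms(1) by (simp add: complex_eq_iff s_def t_def)
    define y where "y = of_real (frac s) * \<tau> + of_real (frac t)"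
    have "x = y + of_int \<lfloor>s\<rfloor> * \<tau> + of_int \<lfloor>t\<rfloor>"
      by (simp add: x y_def frac_def algebra_simps)
    hence "f x = f y" using doubly_periodic_shift[OF assms(3,4)] by simp
    moreover have "norm y \<le> norm \<tau> + 1"
    proof -
      have "norm y \<le> frac s * norm \<tau> + frac t"
        unfolding y_def by (rule order_trans[OF norm_triangle_ineq]) (simp add: norm_mult frac_ge_0)
      also have "\<dots> \<le> 1 * norm \<tau> + 1"
        by (intro add_mono mult_right_mono less_imp_le[OF frac_lt_1]) auto
      finally show ?thesis by simp
    qed
    ultimately show ?thesis by auto
  qed
  moreover have "continuous_on (cball 0 (norm \<tau> + 1)) f"
    by (rule continuous_on_subset[OF holomorphic_on_imp_continuous_on[OF assms(2)]]) simp
  hence "bounded (f ` cball 0 (norm \<tau> + 1))"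
    by (intro compact_imp_bounded compact_continuous_image compact_cball)
  ultimately have "bounded (range f)" by (meson bounded_subset image_subsetI)
  from Liouville_theorem[OF assms(2) this] show ?thesis by (auto simp: constant_on_def)
qed

text \<open>Equal multipliers make f/g doubly periodic. Its singularity at 0 is removable because
  \<open>f\<close> vanishes there and \<open>g\<close> has a simple zero; periodicity carries this
  to all lattice points, so the quotient is constant.\<close>

lemma quasi_periodic_entire_unique:
  assumes "Im \<tau> > 0" and holf: "f holomorphic_on UNIV" and holg: "g holomorphic_on UNIV"
    and f1: "\<And>z. f (z + 1) = \<alpha> z * f z" and g1: "\<And>z. g (z + 1) = \<alpha> z * g z"
    and f\<tau>: "\<And>z. f (z + \<tau>) = \<beta> z * f z" and g\<tau>: "\<And>z. g (z + \<tau>) = \<beta> z * g z"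
    and nz: "\<And>z. \<alpha> z \<noteq> 0" "\<And>z. \<beta> z \<noteq> 0"
    and zeros: "\<And>z. g z = 0 \<longleftrightarrow> (\<exists>m n :: int. z = of_int m * \<tau> + of_int n)"
    and f0: "f 0 = 0"
    and df: "(f has_field_derivative 1) (at 0)" and dg: "(g has_field_derivative 1) (at 0)"
  shows "f z = g z"
proof -
  \<comment> \<open>The value 1 at the zeros of \<open>g\<close> is the limit of f/g at 0, as both
    derivatives there are 1.\<close>
  define \<Phi> where "\<Phi> = (\<lambda>z. if g z = 0 then 1 else f z / g z)"
  have per: "\<Phi> (z + 1) = \<Phi> z" "\<Phi> (z + \<tau>) = \<Phi> z" for z
    using nz by (simp_all add: \<Phi>_def f1 g1 f\<tau> g\<tau>)
  have g0: "g 0 = 0" by (auto simp: zeros intro!: exI[of _ 0])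
  have limf: "(\<lambda>z. f z / z) \<midarrow>0\<rightarrow> 1" using df f0 by (simp add: has_field_derivative_iff)
  have limg: "(\<lambda>z. g z / z) \<midarrow>0\<rightarrow> 1" using dg g0 by (simp add: has_field_derivative_iff)
  have ev: "eventually (\<lambda>z. g z / z \<noteq> 0) (at 0)"
    using limg by (rule tendsto_imp_eventually_ne) simp
  have lim\<Phi>: "\<Phi> \<midarrow>0\<rightarrow> \<Phi> 0"
  proof -
    have "(\<lambda>z. (f z / z) / (g z / z)) \<midarrow>0\<rightarrow> 1 / 1"
      using limf limg by (intro tendsto_divide) auto
    moreover have "eventually (\<lambda>z. (f z / z) / (g z / z) = \<Phi> z) (at 0)"
      using ev by eventually_elim (auto simp: \<Phi>_def)
    ultimately show ?thesis using g0 tendsto_cong by (fastforce simp: \<Phi>_def)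
  qed
  have off: "\<Phi> field_differentiable at z" if "g z \<noteq> 0" for z
  proof -
    have "continuous_on UNIV g" by (rule holomorphic_on_imp_continuous_on[OF holg])
    hence op: "open {z. g z \<noteq> 0}" by (intro open_Collect_neq) auto
    have "(\<lambda>z. f z / g z) holomorphic_on {z. g z \<noteq> 0}"
      using holf holg by (auto intro!: holomorphic_intros elim: holomorphic_on_subset)
    hence "\<Phi> holomorphic_on {z. g z \<noteq> 0}"
      by (rule holomorphic_transform) (auto simp: \<Phi>_def)
    thus ?thesis using op that holomorphic_on_imp_differentiable_at by blast
  qed
  have at0: "\<Phi> field_differentiable at 0"
  proof -
    from ev obtain d where d: "d > 0" "\<And>z. z \<noteq> 0 \<Longrightarrow> dist z 0 < d \<Longrightarrow> g z \<noteq> 0"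
      unfolding eventually_at by auto
    have "\<Phi> holomorphic_on ball 0 d"
    proof (rule no_isolated_singularity')
      show "\<Phi> holomorphic_on ball 0 d - {0}"
        unfolding holomorphic_on_def
        using d by (auto intro!: field_differentiable_at_within off simp: dist_commute)
      show "(\<Phi> \<longlongrightarrow> \<Phi> z) (at z within ball 0 d)" if "z \<in> {0}" for z
        using lim\<Phi> that by (auto intro: tendsto_within_subset)
    qed auto
    thus ?thesis using d by (auto intro: holomorphic_on_imp_differentiable_at)
  qed
  have "\<Phi> field_differentiable at z" for z
  proof (cases "g z = 0")
    case True
    then obtain m n :: int where z: "z = of_int m * \<tau> + of_int n" by (auto simp: zeros)
    \<comment> \<open>Differentiability at 0 is transported to the lattice point \<open>z\<close> by
      translation.\<close>
    have "\<Phi> \<circ> (\<lambda>w. w - z) field_differentiable at z"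
      using at0 by (intro field_differentiable_compose derivative_intros) (auto simp: field_differentiable_diff)
    moreover have "(\<Phi> \<circ> (\<lambda>w. w - z)) w = \<Phi> w" for w
      using doubly_periodic_shift[of \<Phi> \<tau> "w - z" m n, OF per] by (simp add: z)
    hence "\<Phi> \<circ> (\<lambda>w. w - z) = \<Phi>" by auto
    ultimately show ?thesis by simp
  qed (rule off)
  hence hol: "\<Phi> holomorphic_on UNIV" by (auto simp: holomorphic_on_def)
  have "\<Phi> z = \<Phi> 0" by (rule doubly_periodic_entire_eq[OF assms(1) hol per])
  hence "\<Phi> z = 1" by (simp add: \<Phi>_def g0)
  show ?thesis
  proof (cases "g z = 0")
    case True
    then obtain m n :: int where z: "z = of_int m * \<tau> + of_int n" by (auto simp: zeros)
    \<comment> \<open>At a lattice point \<open>\<Phi> z = 1\<close> carries no information about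
      \<open>f\<close>. Instead, the predicate of being a zero of \<open>f\<close> is itself doubly
      periodic, since the multipliers never vanish.\<close>
    have "(f (w + 1) = 0) = (f w = 0)" "(f (w + \<tau>) = 0) = (f w = 0)" for w
      by (simp_all add: f1 f\<tau> nz)
    hence "(f z = 0) = (f 0 = 0)"
      using doubly_periodic_shift[of "\<lambda>w. f w = 0" \<tau> 0 m n] by (simp add: z)
    thus ?thesis using True f0 by simp
  qed (use \<open>\<Phi> z = 1\<close> in \<open>simp add: \<Phi>_def\<close>)
qed

lemma Im_inversion_pos: "Im \<tau> > 0 \<Longrightarrow> Im (- 1 / \<tau>) > 0"
  by (simp add: Im_divide sum_power2_gt_zero_iff)

text \<open>Up to a Gaussian factor, both sides are entire functions of \<open>z\<close> with the
  same multipliers for 1 and \<open>\<tau>\<close> and the same derivative at 0, so uniqueness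
  applies.\<close>

theorem theta_ratio_inversion:
  assumes "Im \<tau> > 0"
  shows "theta_ratio (z / \<tau>) (- 1 / \<tau>) = ee (z ^ 2 / (2 * \<tau>)) / \<tau> * theta_ratio z \<tau>"
proof -
  have [simp]: "\<tau> \<noteq> 0" using assms by auto
  have im: "Im (- 1 / \<tau>) > 0" using assms by (rule Im_inversion_pos)
  define \<tau>' where "\<tau>' = - 1 / \<tau>"
  have im': "Im \<tau>' > 0" using im by (simp add: \<tau>'_def)
  \<comment> \<open>The claimed identity solved for \<open>theta_ratio z \<tau>\<close>: the
    Gaussian corrects the multipliers, and the factor \<open>\<tau>\<close> restores the derivative
    1 at 0.\<close>
  define f where "f = (\<lambda>z. \<tau> * ee (- (z ^ 2 / (2 * \<tau>))) * theta_ratio (z / \<tau>) \<tau>')"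
  have "f z = theta_ratio z \<tau>"
  proof (rule quasi_periodic_entire_unique[OF assms, where f = f and g = "\<lambda>z. theta_ratio z \<tau>" and z = z
        and \<alpha> = "\<lambda>_. -1" and \<beta> = "\<lambda>z. - ee (- \<tau> / 2 - z)"])
    show "f holomorphic_on UNIV" "(\<lambda>z. theta_ratio z \<tau>) holomorphic_on UNIV"
      unfolding f_def using im' assms by (auto intro!: holomorphic_intros)
    show "theta_ratio (z + 1) \<tau> = - 1 * theta_ratio z \<tau>" for z by (simp add: theta_ratio_add_1)
    show "theta_ratio (z + \<tau>) \<tau> = - ee (- \<tau> / 2 - z) * theta_ratio z \<tau>" for z
      by (rule theta_ratio_add_tau[OF assms])
    show "f (z + 1) = - 1 * f z" for z
    proof -
      \<comment> \<open>Adding 1 to \<open>z\<close> subtracts \<open>\<tau>'\<close> from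
        \<open>z / \<tau>\<close>, so quasi-periodicity in \<open>\<tau>'\<close> is used
        backwards.\<close>
      have e: "(z + 1) / \<tau> + \<tau>' = z / \<tau>" by (simp add: \<tau>'_def field_simps)
      have "theta_ratio (z / \<tau>) \<tau>' = - ee (- \<tau>' / 2 - (z + 1) / \<tau>) * theta_ratio ((z + 1) / \<tau>) \<tau>'"
        using theta_ratio_add_tau[OF im', of "(z + 1) / \<tau>"] unfolding e .
      hence "f z = - (\<tau> * (ee (- (z ^ 2 / (2 * \<tau>))) * ee (- \<tau>' / 2 - (z + 1) / \<tau>)) * theta_ratio ((z + 1) / \<tau>) \<tau>')"
        by (simp add: f_def)
      also have "ee (- (z ^ 2 / (2 * \<tau>))) * ee (- \<tau>' / 2 - (z + 1) / \<tau>) = ee (- ((z + 1) ^ 2 / (2 * \<tau>)))"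
        unfolding ee_add[symmetric] by (intro arg_cong[of _ _ ee]) (simp add: \<tau>'_def field_simps power2_eq_square)
      finally show ?thesis by (simp add: f_def)
    qed
    show "f (z + \<tau>) = - ee (- \<tau> / 2 - z) * f z" for z
    proof -
      have "theta_ratio ((z + \<tau>) / \<tau>) \<tau>' = - theta_ratio (z / \<tau>) \<tau>'"
        using theta_ratio_add_1[of "z / \<tau>" \<tau>'] by (simp add: add_divide_distrib)
      moreover have "ee (- ((z + \<tau>) ^ 2 / (2 * \<tau>))) = ee (- \<tau> / 2 - z) * ee (- (z ^ 2 / (2 * \<tau>)))"
        unfolding ee_add[symmetric] by (intro arg_cong[of _ _ ee]) (simp add: field_simps power2_eq_square)
      ultimately show ?thesis by (simp add: f_def)
    qed
    show "f 0 = 0" using theta_ratio_eq_0_iff[OF im', of 0] by (auto simp: f_def intro!: exI[of _ 0])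
    show "(f has_field_derivative 1) (at 0)"
    proof -
      have 1: "((\<lambda>z. theta_ratio (z / \<tau>) \<tau>') has_field_derivative 1 * (1 / \<tau>)) (at 0)"
      proof (rule DERIV_chain2[where f = "\<lambda>z. theta_ratio z \<tau>'" and g = "\<lambda>z. z / \<tau>"])
        show "((\<lambda>z. theta_ratio z \<tau>') has_field_derivative 1) (at (0 / \<tau>))"
          using has_field_derivative_theta_ratio_0[OF im'] by simp
        show "((\<lambda>z. z / \<tau>) has_field_derivative 1 / \<tau>) (at 0)"
          by (auto intro!: derivative_eq_intros)
      qed
      have "(\<lambda>z. \<tau> * ee (- (z ^ 2 / (2 * \<tau>)))) holomorphic_on UNIV"
        by (auto intro!: holomorphic_intros)
      from DERIV_mult[OF holomorphic_derivI[OF this open_UNIV UNIV_I] 1]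
      show ?thesis using \<open>f 0 = 0\<close> by (simp add: f_def)
    qed
  qed (use assms theta_ratio_eq_0_iff has_field_derivative_theta_ratio_0 in auto)
  thus ?thesis by (simp add: f_def \<tau>'_def ee_minus field_simps)
qed

section \<open>The modular group and Klein forms\<close>

text \<open>Translations and the inversion generate the modular group: Euclid's algorithm on the
  first column lowers the lower left entry until it is 0, which leaves a translation up to
  sign.\<close>

lemma SL2Z_induct [consumes 1, case_names translation neg_translation shift inversion]:
  assumes "A \<in> SL2Z"
    and transl: "\<And>n. P (1, n, 0, 1)" and neg: "\<And>n. P (-1, n, 0, -1)"
    and shift: "\<And>a b c d n. (a, b, c, d) \<in> SL2Z \<Longrightarrow> P (a, b, c, d) \<Longrightarrow> P (a + n * c, b + n * d, c, d)"
    and inversion: "\<And>a b c d. (a, b, c, d) \<in> SL2Z \<Longrightarrow> P (a, b, c, d) \<Longrightarrow> P (- c, - d, a, b)"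
  shows "P A"
proof -
  obtain a b c d where A: "A = (a, b, c, d)" by (cases A)
  have "(a, b, c, d) \<in> SL2Z \<Longrightarrow> P (a, b, c, d)" for a b c d
  proof (induction "nat \<bar>c\<bar>" arbitrary: a b c d rule: less_induct)
    case less
    have det: "a * d - b * c = 1" using less.prems by (simp add: SL2Z_def)
    show ?case
    proof (cases "c = 0")
      case True
      hence "a * d = 1" using det by simp
      hence "a = 1 \<and> d = 1 \<or> a = -1 \<and> d = -1" using zmult_eq_1_iff by blast
      thus ?thesis using True transl neg by auto
    next
      case False
      \<comment> \<open>Dividing with remainder replaces \<open>a\<close> by \<open>a mod c\<close>;
        an inversion then moves it, up to sign, to the lower left position, where it is smaller than
        \<open>c\<close> in absolute value.\<close>
      define n where "n = a div c"
      have r: "a - n * c = a mod c" unfolding n_def by (simp add: minus_div_mult_eq_mod)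
      have "nat \<bar>- (a - n * c)\<bar> < nat \<bar>c\<bar>"
        unfolding r using False abs_mod_less[of c a] by simp
      moreover have B: "(c, d, - (a - n * c), - (b - n * d)) \<in> SL2Z"
        using det by (simp add: SL2Z_def algebra_simps)
      ultimately have "P (c, d, - (a - n * c), - (b - n * d))" by (rule less.hyps)
      from inversion[OF B this] have "P (a - n * c, b - n * d, c, d)" by simp
      moreover have "(a - n * c, b - n * d, c, d) \<in> SL2Z"
        using det by (simp add: SL2Z_def algebra_simps)
      ultimately have "P ((a - n * c) + n * c, (b - n * d) + n * d, c, d)" by (intro shift)
      thus ?thesis by simp
    qed
  qed
  thus ?thesis using assms(1) A by simp
qed

lemma automorphy_factor_nonzero:
  assumes "(a, b, c, d) \<in> SL2Z" "Im \<tau> > 0"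
  shows "of_int c * \<tau> + of_int d \<noteq> (0::complex)"
proof
  assume *: "of_int c * \<tau> + of_int d = (0::complex)"
  hence "of_int c * Im \<tau> = 0" by (simp add: complex_eq_iff)
  hence "c = 0" using assms by simp
  moreover from this have "d = 0" using * by simp
  ultimately show False using assms by (simp add: SL2Z_def)
qed

lemma Im_moebius:
  assumes "(a, b, c, d) \<in> SL2Z"
  shows "Im (moebius (a, b, c, d) \<tau>) = Im \<tau> / norm (of_int c * \<tau> + of_int d) ^ 2"
proof -
  have "real_of_int a * real_of_int d - real_of_int b * real_of_int c = 1"
    using assms by (simp add: SL2Z_def flip: of_int_mult of_int_diff)
  hence "real_of_int a * real_of_int d = 1 + real_of_int b * real_of_int c" by simp
  thus ?thesis
    unfolding moebius.simps by (simp add: Im_divide cmod_power2) (simp add: algebra_simps)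
qed

lemma Im_moebius_pos:
  assumes "(a, b, c, d) \<in> SL2Z" "Im \<tau> > 0"
  shows "Im (moebius (a, b, c, d) \<tau>) > 0"
  using automorphy_factor_nonzero[OF assms] assms by (simp add: Im_moebius del: moebius.simps)

lemma moebius_shift:
  assumes "(a, b, c, d) \<in> SL2Z" "Im \<tau> > 0"
  shows "moebius (a + n * c, b + n * d, c, d) \<tau> = moebius (a, b, c, d) \<tau> + of_int n"
  using automorphy_factor_nonzero[OF assms] by (simp add: field_simps)

lemma moebius_inversion:
  "moebius (- c, - d, a, b) \<tau> = - 1 / moebius (a, b, c, d) \<tau>"
  by (simp add: field_simps)

text \<open>The classical Klein form with characteristic \<open>(u, v)\<close>, belonging to the
  point \<open>z = u * \<tau> + v\<close>. Its exponential prefactor is what absorbs the Gaussian in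
  \<open>theta_ratio_inversion\<close>.\<close>

definition klein_form :: "complex \<Rightarrow> complex \<Rightarrow> complex \<Rightarrow> complex" where
  "klein_form u v \<tau> = ee (u * (u * \<tau> + v) / 2) * theta_ratio (u * \<tau> + v) \<tau>"

lemma klein_form_minus: "Im \<tau> > 0 \<Longrightarrow> klein_form (- u) (- v) \<tau> = - klein_form u v \<tau>"
  using theta_ratio_minus[of \<tau> "u * \<tau> + v"] by (simp add: klein_form_def algebra_simps)

lemma klein_form_shift: "klein_form u v (\<tau> + of_int n) = klein_form u (u * of_int n + v) \<tau>"
proof -
  have "theta_ratio z (\<tau> + of_int n) = theta_ratio z \<tau>" for z
    by (simp add: theta_ratio_def ee_add ee_diff)
  thus ?thesis by (simp add: klein_form_def algebra_simps)
qed

text \<open>The point of the left side is z / \<tau> with \<open>z = v * \<tau> - u\<close>, and the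
  Gaussian combines with one exponential prefactor into the other.\<close>

lemma klein_form_inversion:
  assumes "Im \<tau> > 0"
  shows "klein_form u v (- 1 / \<tau>) = klein_form v (- u) \<tau> / \<tau>"
proof -
  have [simp]: "\<tau> \<noteq> 0" using assms by auto
  define z where "z = v * \<tau> + (- u)"
  have z: "u * (- 1 / \<tau>) + v = z / \<tau>" by (simp add: z_def field_simps)
  have "klein_form u v (- 1 / \<tau>) = ee (u * (z / \<tau>) / 2) * ee (z ^ 2 / (2 * \<tau>)) / \<tau> * theta_ratio z \<tau>"
    unfolding klein_form_def z theta_ratio_inversion[OF assms] by simp
  also have "ee (u * (z / \<tau>) / 2) * ee (z ^ 2 / (2 * \<tau>)) = ee (v * z / 2)"
    unfolding ee_add[symmetric] by (intro arg_cong[of _ _ ee]) (simp add: z_def field_simps power2_eq_square)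
  finally show ?thesis unfolding klein_form_def z_def by simp
qed

text \<open>The characteristic is acted on as a row vector by right multiplication with
  \<open>A\<close>. It changes from generator to generator, so the induction generalizes over
  \<open>u\<close> and \<open>v\<close>.\<close>

theorem klein_form_moebius:
  assumes "A \<in> SL2Z" "Im \<tau> > 0"
  shows "case A of (a, b, c, d) \<Rightarrow> klein_form u v (moebius A \<tau>) =
    klein_form (u * of_int a + v * of_int c) (u * of_int b + v * of_int d) \<tau> / (of_int c * \<tau> + of_int d)"
  using assms(1)
proof (induction A arbitrary: u v rule: SL2Z_induct)
  case (translation n)
  show ?case by (simp add: klein_form_shift)
next
  case (neg_translation n)
  \<comment> \<open>The sign of the matrix does not affect the action on \<tau>; oddness of the
    Klein form accounts for the automorphy factor -1.\<close>
  show ?case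
    using klein_form_shift[of u v \<tau> "-n"] klein_form_minus[OF assms(2), of u "v - u * of_int n"] by simp
next
  case (shift a b c d n)
  have "klein_form u v (moebius (a + n * c, b + n * d, c, d) \<tau>) =
      klein_form u (u * of_int n + v) (moebius (a, b, c, d) \<tau>)"
    by (simp only: moebius_shift[OF shift(1) assms(2)] klein_form_shift)
  also have "\<dots> = klein_form (u * of_int a + (u * of_int n + v) * of_int c)
      (u * of_int b + (u * of_int n + v) * of_int d) \<tau> / (of_int c * \<tau> + of_int d)"
    using shift(2) by simp
  finally show ?case by (simp add: algebra_simps)
next
  case (inversion a b c d)
  define w where "w = moebius (a, b, c, d) \<tau>"
  have w: "Im w > 0" unfolding w_def by (rule Im_moebius_pos[OF inversion(1) assms(2)])
  have "klein_form u v (moebius (- c, - d, a, b) \<tau>) = klein_form v (- u) w / w"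
    unfolding moebius_inversion w_def[symmetric] by (rule klein_form_inversion[OF w])
  also have "klein_form v (- u) w = klein_form (v * of_int a + (- u) * of_int c) (v * of_int b + (- u) * of_int d) \<tau>
      / (of_int c * \<tau> + of_int d)"
    unfolding w_def using inversion(2)[of v "-u"] by simp
  also have "\<dots> / w = klein_form (v * of_int a + (- u) * of_int c) (v * of_int b + (- u) * of_int d) \<tau>
      / (of_int a * \<tau> + of_int b)"
    using automorphy_factor_nonzero[OF inversion(1) assms(2)] by (simp add: w_def)
  finally show ?case by (simp add: algebra_simps)
qed

lemma klein_form_0_add_int:
  "klein_form 0 (v + of_int n) \<tau> = (-1) powi n * klein_form 0 v \<tau>"
proof -
  have "klein_form 0 (v + 1) \<tau> = - klein_form 0 v \<tau>" for v
    by (simp add: klein_form_def theta_ratio_add_1)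
  note step = this
  show ?thesis
  proof (induction n rule: int_induct[of _ 0])
    case (step1 i)
    show ?case using step[of "v + of_int i"] step1 by (simp add: power_int_add add.assoc)
  next
    case (step2 i)
    show ?case using step[of "v + of_int (i - 1)"] step2
      by (simp add: power_int_diff add.assoc) 
  qed simp
qed

text \<open>With \<open>klein_form_0_add_int\<close> this brings a characteristic that is
  \<open>(0, v)\<close> modulo integers back to \<open>(0, v)\<close>, at the cost of explicit
  exponential factors.\<close>

lemma klein_form_of_int:
  assumes "Im \<tau> > 0"
  shows "klein_form (of_int m) v \<tau> = (- ee (- v / 2)) powi m * klein_form 0 v \<tau>"
proof -
  have step: "klein_form (u + 1) v \<tau> = - ee (- v / 2) * klein_form u v \<tau>" for u
  proof -
    have "klein_form (u + 1) v \<tau> = - (ee ((u + 1) * ((u + 1) * \<tau> + v) / 2) * ee (- \<tau> / 2 - (u * \<tau> + v))) *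
        theta_ratio (u * \<tau> + v) \<tau>"
      using theta_ratio_add_tau[OF assms, of "u * \<tau> + v"] by (simp add: klein_form_def algebra_simps)
    also have "ee ((u + 1) * ((u + 1) * \<tau> + v) / 2) * ee (- \<tau> / 2 - (u * \<tau> + v)) =
        ee (- v / 2) * ee (u * (u * \<tau> + v) / 2)"
      unfolding ee_add[symmetric] by (intro arg_cong[of _ _ ee]) (simp add: field_simps)
    finally show ?thesis by (simp add: klein_form_def)
  qed
  show ?thesis
  proof (induction m rule: int_induct[of _ 0])
    case (step1 i)
    show ?case using step[of "of_int i"] step1 by (simp add: power_int_add)
  next
    case (step2 i)
    show ?case using step[of "of_int (i - 1)"] step2 by (simp add: power_int_diff field_simps)
  qed simp
qed

section \<open>The Dedekind eta function\<close>

lemma dedekind_eta_eq: "dedekind_eta \<tau> = ee (\<tau> / 24) * qpoch (ee \<tau>) (ee \<tau>)"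
  by (simp add: dedekind_eta_def ee_def qpoch_def)

lemma dedekind_eta_nonzero: "Im \<tau> > 0 \<Longrightarrow> dedekind_eta \<tau> \<noteq> 0"
  using norm_ee_less_1[of \<tau>] by (simp add: dedekind_eta_eq qpoch_nonzero)

lemma holomorphic_on_dedekind_eta [holomorphic_intros]:
  assumes "f holomorphic_on S" "open S" "\<And>z. z \<in> S \<Longrightarrow> Im (f z) > 0"
  shows "(\<lambda>z. dedekind_eta (f z)) holomorphic_on S"
  unfolding dedekind_eta_eq using norm_ee_less_1 assms by (intro holomorphic_intros) auto

lemma dedekind_eta_add_int: "dedekind_eta (\<tau> + of_int n) = ee (of_int n / 24) * dedekind_eta \<tau>"
  by (simp add: dedekind_eta_eq ee_add add_divide_distrib)

section \<open>Klein forms of order 2 and the inversion of the 24th power of eta\<close>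

lemma qpoch_bisect:
  assumes "norm q < 1"
  shows "qpoch x q = qpoch x (q ^ 2) * qpoch (x * q) (q ^ 2)"
proof -
  have q2: "norm (q ^ 2) < 1"
    using assms by (simp add: norm_power power_less_one_iff)
  have lim: "(\<lambda>n. \<Prod>k<n. 1 - y * r ^ k) \<longlonglongrightarrow> qpoch y r" if "norm r < 1" for y r
    unfolding qpoch_def using that
    by (intro has_prod_imp_tendsto' convergent_prod_has_prod convergent_prod_qpoch)
  \<comment> \<open>Partial products of even length split exactly into even and odd exponents, so no
    infinite product has to be rearranged.\<close>
  have "(\<lambda>n. \<Prod>k<2 * n. 1 - x * q ^ k) \<longlonglongrightarrow> qpoch x q"
    by (rule filterlim_compose[OF lim[OF assms]]) (auto intro!: mult_nat_left_at_top)
  moreover have "(\<Prod>k<2 * n. 1 - x * q ^ k) = (\<Prod>k<n. 1 - x * (q ^ 2) ^ k) * (\<Prod>k<n. 1 - (x * q) * (q ^ 2) ^ k)" for n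
    by (induction n) (simp_all add: mult_ac flip: power_mult)
  ultimately have "(\<lambda>n. (\<Prod>k<n. 1 - x * (q ^ 2) ^ k) * (\<Prod>k<n. 1 - (x * q) * (q ^ 2) ^ k)) \<longlonglongrightarrow> qpoch x q"
    by simp
  moreover have "(\<lambda>n. (\<Prod>k<n. 1 - x * (q ^ 2) ^ k) * (\<Prod>k<n. 1 - (x * q) * (q ^ 2) ^ k))
      \<longlonglongrightarrow> qpoch x (q ^ 2) * qpoch (x * q) (q ^ 2)"
    by (intro tendsto_mult lim q2)
  ultimately show ?thesis by (rule LIMSEQ_unique)
qed

text \<open>At \<open>z = 1 / 2\<close> both products reduce to \<open>qpoch (- q) q\<close>, up to
  a leading factor 2, and \<open>qpoch q q * qpoch (- q) q\<close> is the Euler product at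
  \<open>q ^ 2\<close>.\<close>

lemma klein_form_0_half:
  assumes "Im \<tau> > 0"
  shows "klein_form 0 (1 / 2) \<tau> =
    \<i> / of_real pi * ee (- (1 / 4)) * dedekind_eta (2 * \<tau>) ^ 2 / dedekind_eta \<tau> ^ 4"
proof -
  define q where "q = ee \<tau>"
  have q: "norm q < 1" unfolding q_def by (rule norm_ee_less_1[OF assms])
  have nz: "qpoch q q \<noteq> 0" by (rule qpoch_nonzero[OF q q])
  have q2: "ee (2 * \<tau>) = q ^ 2" using ee_of_nat_mult[of 2 \<tau>] by (simp add: q_def)
  have 1: "qpoch q q * qpoch (- q) q = qpoch (q ^ 2) (q ^ 2)"
    using prod_qpoch_roots_of_unity[OF q, of 2 q] by (simp add: numeral_2_eq_2 mult_ac)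
  have "klein_form 0 (1 / 2) \<tau> = \<i> / (2 * of_real pi) * ee (- (1 / 4)) * (2 * qpoch (- q) q) * qpoch (- q) q / qpoch q q ^ 2"
    using qpoch_rec[OF q, of "-1"] by (simp add: klein_form_def theta_ratio_def ee_diff q_def)
  also have "\<dots> = \<i> / of_real pi * ee (- (1 / 4)) * (qpoch q q * qpoch (- q) q) ^ 2 / qpoch q q ^ 4"
    using nz by (simp add: field_simps power2_eq_square power4_eq_xxxx)
  also have "\<dots> = \<i> / of_real pi * ee (- (1 / 4)) * (qpoch (q ^ 2) (q ^ 2) ^ 2 / qpoch q q ^ 4)"
    by (simp only: 1 times_divide_eq_right)
  also have "qpoch (q ^ 2) (q ^ 2) ^ 2 / qpoch q q ^ 4 = dedekind_eta (2 * \<tau>) ^ 2 / dedekind_eta \<tau> ^ 4"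
  proof -
    have "ee (2 * \<tau> / 24) ^ 2 = ee (\<tau> / 24) ^ 4"
      unfolding ee_of_nat_mult[symmetric] by simp
    thus ?thesis by (simp add: dedekind_eta_eq q2 flip: q_def) (simp add: power_mult_distrib)
  qed
  finally show ?thesis by (simp add: mult_ac)
qed

text \<open>At \<open>z = \<tau> / 2\<close> both products have argument
  \<open>s = ee (\<tau> / 2)\<close> and run over its odd powers; the even powers complete them to
  the Euler product at \<open>s\<close>.\<close>

lemma klein_form_half_0:
  assumes "Im \<tau> > 0"
  shows "klein_form (1 / 2) 0 \<tau> = \<i> / (2 * of_real pi) * dedekind_eta (\<tau> / 2) ^ 2 / dedekind_eta \<tau> ^ 4"
proof -
  define s where "s = ee (\<tau> / 2)"
  have s: "norm s < 1" unfolding s_def using assms by (intro norm_ee_less_1) simp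
  have s2: "ee \<tau> = s ^ 2" using ee_of_nat_mult[of 2 "\<tau> / 2"] by (simp add: s_def)
  have s2': "norm (s ^ 2) < 1" using s by (simp add: norm_power power_less_one_iff)
  have nz: "qpoch (s ^ 2) (s ^ 2) \<noteq> 0" by (rule qpoch_nonzero[OF s2' s2'])
  have 1: "qpoch s s = qpoch s (s ^ 2) * qpoch (s ^ 2) (s ^ 2)"
    using qpoch_bisect[OF s, of s] by (simp add: power2_eq_square)
  have "klein_form (1 / 2) 0 \<tau> = \<i> / (2 * of_real pi) * (ee (\<tau> / 8) * ee (- (\<tau> / 4))) *
      qpoch s (s ^ 2) ^ 2 / qpoch (s ^ 2) (s ^ 2) ^ 2"
  proof -
    have "\<tau> - \<tau> / 2 = \<tau> / 2" by simp
    thus ?thesis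
      by (simp add: klein_form_def theta_ratio_def s2 power2_eq_square flip: s_def)
  qed
  also have "\<dots> = \<i> / (2 * of_real pi) * (ee (\<tau> / 8) * ee (- (\<tau> / 4))) * qpoch s s ^ 2 / qpoch (s ^ 2) (s ^ 2) ^ 4"
    using nz by (simp add: 1 field_simps power2_eq_square power4_eq_xxxx)
  also have "\<dots> = \<i> / (2 * of_real pi) * dedekind_eta (\<tau> / 2) ^ 2 / dedekind_eta \<tau> ^ 4"
  proof -
    have "ee (\<tau> / 8) * ee (- (\<tau> / 4)) * ee (\<tau> / 24) ^ 4 = ee (\<tau> / 2 / 24) ^ 2"
      unfolding ee_of_nat_mult[symmetric] ee_add[symmetric] by (intro arg_cong[of _ _ ee]) simp
    thus ?thesis using nz
      by (simp add: dedekind_eta_eq s2 flip: s_def) (simp add: power_mult_distrib field_simps)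
  qed
  finally show ?thesis .
qed

text \<open>Inversion exchanges the characteristics (0, 1/2) and (1/2, 0) up to sign, which ties the
  ratio \<open>R\<close> at \<open>\<tau>\<close> to its value at \<open>\<tau> / 2\<close>. Using
  this relation twice eliminates \<open>R (\<tau> / 2)\<close> and shows that
  \<open>R \<tau> ^ 6\<close> is a constant multiple of \<open>\<tau> ^ 3\<close>.\<close>

theorem dedekind_eta_inversion_24:
  assumes "Im \<tau> > 0"
  shows "dedekind_eta (- 1 / \<tau>) ^ 24 = \<tau> ^ 12 * dedekind_eta \<tau> ^ 24"
proof -
  define R where "R = (\<lambda>\<tau>. dedekind_eta (- 1 / \<tau>) / dedekind_eta \<tau>)"
  define C where "C = 1 / (2 * ee (- (1 / 4)))"
  have C: "C \<noteq> 0" by (simp add: C_def)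
  have R_nz: "R \<tau> \<noteq> 0" if "Im \<tau> > 0" for \<tau>
    using that Im_inversion_pos[OF that] by (simp add: R_def dedekind_eta_nonzero)
  have R_inv: "R (- 1 / \<tau>) = 1 / R \<tau>" for \<tau> by (simp add: R_def)
  have eq1: "\<tau> * R (\<tau> / 2) ^ 2 = C * R \<tau> ^ 4" if \<tau>: "Im \<tau> > 0" for \<tau>
  proof -
    have [simp]: "\<tau> \<noteq> 0" using \<tau> by auto
    have im: "Im (- 1 / \<tau>) > 0" using \<tau> by (rule Im_inversion_pos)
    have \<tau>2: "2 * (- 1 / \<tau>) = - 1 / (\<tau> / 2)" by simp
    have nz: "dedekind_eta (- 1 / \<tau>) \<noteq> 0" "dedekind_eta \<tau> \<noteq> 0" "dedekind_eta (\<tau> / 2) \<noteq> 0"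
      using \<tau> im by (auto intro!: dedekind_eta_nonzero simp del: Im_divide)
    have "\<i> / of_real pi * ee (- (1 / 4)) * dedekind_eta (- 1 / (\<tau> / 2)) ^ 2 / dedekind_eta (- 1 / \<tau>) ^ 4
        = \<i> / (2 * of_real pi) * dedekind_eta (\<tau> / 2) ^ 2 / dedekind_eta \<tau> ^ 4 / \<tau>"
      using klein_form_inversion[OF \<tau>, of 0 "1 / 2"] klein_form_half_0[OF \<tau>] klein_form_0_half[OF im]
      unfolding \<tau>2 by simp
    thus ?thesis using nz by (simp add: R_def C_def field_simps)
  qed
  have R6: "R \<tau> ^ 6 = - (\<tau> ^ 3) / (2 * C)" if \<tau>: "Im \<tau> > 0" for \<tau>
  proof -
    have [simp]: "\<tau> \<noteq> 0" using \<tau> by auto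
    have h: "Im (\<tau> / 2) > 0" using \<tau> by simp
    \<comment> \<open>The relation is reused at -2/\<tau>, whose half is -1/\<tau>; there
      \<open>R_inv\<close> turns both values of \<open>R\<close> into reciprocals of those at
      \<open>\<tau> / 2\<close> and \<open>\<tau>\<close>.\<close>
    have "Im (- 1 / (\<tau> / 2)) > 0" by (rule Im_inversion_pos[OF h])
    from eq1[OF this] have "(- 1 / (\<tau> / 2)) * R (- 1 / \<tau>) ^ 2 = C * R (- 1 / (\<tau> / 2)) ^ 4" by simp
    hence "(- 2 / \<tau>) * (1 / R \<tau>) ^ 2 = C * (1 / R (\<tau> / 2)) ^ 4" unfolding R_inv by simp
    hence 2: "- 2 * R (\<tau> / 2) ^ 4 = C * \<tau> * R \<tau> ^ 2"
      using R_nz[OF \<tau>] R_nz[OF h] by (simp add: field_simps)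
    have "\<tau> ^ 2 * R (\<tau> / 2) ^ 4 = (\<tau> * R (\<tau> / 2) ^ 2) ^ 2"
      by (simp add: power_mult_distrib flip: power_mult)
    also have "\<dots> = C ^ 2 * R \<tau> ^ 8" unfolding eq1[OF \<tau>] by (simp add: power_mult_distrib flip: power_mult)
    finally have "- 2 * (C ^ 2 * R \<tau> ^ 8) = \<tau> ^ 2 * (- 2 * R (\<tau> / 2) ^ 4)" by simp
    also have "\<dots> = \<tau> ^ 2 * (C * \<tau> * R \<tau> ^ 2)" unfolding 2 by simp
    finally have "(C * R \<tau> ^ 2) * (- 2 * C * R \<tau> ^ 6) = (C * R \<tau> ^ 2) * \<tau> ^ 3"
      using power_add[of "R \<tau>" 2 6] by (simp add: algebra_simps power2_eq_square power3_eq_cube)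
    moreover have "C * R \<tau> ^ 2 \<noteq> 0" using C R_nz[OF \<tau>] by simp
    ultimately have "- 2 * C * R \<tau> ^ 6 = \<tau> ^ 3" using mult_left_cancel by blast
    hence "\<tau> ^ 3 = - (2 * C * R \<tau> ^ 6)" by simp
    thus ?thesis using C by simp
  qed
  have R24: "R \<tau> ^ 24 = \<tau> ^ 12 / (2 * C) ^ 4" if "Im \<tau> > 0" for \<tau>
  proof -
    have "R \<tau> ^ 24 = (R \<tau> ^ 6) ^ 4" by (simp flip: power_mult)
    thus ?thesis by (simp add: R6[OF that] power_divide flip: power_mult)
  qed
  text \<open>The constant is found at the fixed point \<open>\<tau> = \<i>\<close>.\<close>
  have "R \<i> = 1" by (simp add: R_def dedekind_eta_nonzero)
  hence "(2 * C) ^ 4 = \<i> ^ 12" using R24[of \<i>] C by (simp add: field_simps)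
  hence "R \<tau> ^ 24 = \<tau> ^ 12" using R24[OF assms] by simp
  thus ?thesis using dedekind_eta_nonzero[OF assms] by (simp add: R_def power_divide field_simps)
qed

theorem dedekind_eta_moebius_24:
  assumes "A \<in> SL2Z" "Im \<tau> > 0"
  shows "dedekind_eta (moebius A \<tau>) ^ 24 = automorphy_factor A \<tau> ^ 12 * dedekind_eta \<tau> ^ 24"
proof -
  have shift: "dedekind_eta (z + of_int n) ^ 24 = dedekind_eta z ^ 24" for z and n :: int
    using ee_of_nat_mult[of 24 "of_int n / 24"] by (simp add: dedekind_eta_add_int power_mult_distrib)
  show ?thesis using assms(1)
  proof (induction A rule: SL2Z_induct)
    case (translation n)
    show ?case by (simp add: shift)
  next
    case (neg_translation n)
    show ?case using shift[of \<tau> "-n"] by simp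
  next
    case (shift a b c d n)
    thus ?case by (simp only: moebius_shift[OF _ assms(2)] \<open>\<And>z n. dedekind_eta (z + of_int n) ^ 24 = dedekind_eta z ^ 24\<close> automorphy_factor.simps)
  next
    case (inversion a b c d)
    define w where "w = moebius (a, b, c, d) \<tau>"
    have w: "Im w > 0" unfolding w_def by (rule Im_moebius_pos[OF inversion(1) assms(2)])
    have nz: "of_int c * \<tau> + of_int d \<noteq> 0" by (rule automorphy_factor_nonzero[OF inversion(1) assms(2)])
    have "dedekind_eta (moebius (- c, - d, a, b) \<tau>) ^ 24 = w ^ 12 * dedekind_eta w ^ 24"
      unfolding moebius_inversion w_def[symmetric] by (rule dedekind_eta_inversion_24[OF w])
    also have "\<dots> = (w * (of_int c * \<tau> + of_int d)) ^ 12 * dedekind_eta \<tau> ^ 24"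
      using inversion(2) unfolding w_def[symmetric] by (simp add: power_mult_distrib)
    also have "w * (of_int c * \<tau> + of_int d) = of_int a * \<tau> + of_int b"
      using nz by (simp add: w_def)
    finally show ?case by simp
  qed
qed

text \<open>Nonnegative reals have unique 24th roots, so absolute values avoid the multiplier system
  of eta while still detecting the weight.\<close>

lemma norm_dedekind_eta_inversion:
  assumes "Im \<tau> > 0"
  shows "norm (dedekind_eta (- 1 / \<tau>)) = sqrt (norm \<tau>) * norm (dedekind_eta \<tau>)"
proof -
  have "norm (dedekind_eta (- 1 / \<tau>)) ^ 24 = (sqrt (norm \<tau>) ^ 2) ^ 12 * norm (dedekind_eta \<tau>) ^ 24"
    using arg_cong[OF dedekind_eta_inversion_24[OF assms], of norm] by (simp add: norm_mult norm_power)
  also have "\<dots> = (sqrt (norm \<tau>) * norm (dedekind_eta \<tau>)) ^ 24"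
    by (simp add: power_mult_distrib del: real_sqrt_pow2 flip: power_mult)
  finally show ?thesis by (rule power_eq_imp_eq_base) auto
qed

text \<open>The matrix with rows \<open>(1, 0)\<close> and \<open>(m, 1)\<close> is \<open>S T\<^bsup>-m\<^esup> S\<^bsup>-1\<^esup>\<close>.\<close>

lemma norm_dedekind_eta_lower_triangular:
  assumes "Im \<tau> > 0"
  shows "norm (dedekind_eta (\<tau> / (of_int m * \<tau> + 1))) =
    sqrt (norm (of_int m * \<tau> + 1)) * norm (dedekind_eta \<tau>)"
proof -
  have [simp]: "\<tau> \<noteq> 0" using assms by auto
  define \<sigma> where "\<sigma> = - 1 / \<tau> + of_int (- m)"
  have im: "Im \<sigma> > 0" using Im_inversion_pos[OF assms] by (simp add: \<sigma>_def)
  have \<sigma>: "\<sigma> = - ((of_int m * \<tau> + 1) / \<tau>)" by (simp add: \<sigma>_def field_simps)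
  have e: "\<tau> / (of_int m * \<tau> + 1) = - 1 / \<sigma>" unfolding \<sigma> by simp
  have "norm (dedekind_eta \<sigma>) = norm (dedekind_eta (- 1 / \<tau>))"
    unfolding \<sigma>_def dedekind_eta_add_int by (simp add: norm_mult norm_ee)
  hence "norm (dedekind_eta (\<tau> / (of_int m * \<tau> + 1))) = sqrt (norm \<sigma> * norm \<tau>) * norm (dedekind_eta \<tau>)"
    unfolding e norm_dedekind_eta_inversion[OF im] norm_dedekind_eta_inversion[OF assms]
    by (simp add: real_sqrt_mult)
  also have "norm \<sigma> * norm \<tau> = norm (\<sigma> * \<tau>)" by (simp add: norm_mult)
  also have "\<sigma> * \<tau> = - (of_int m * \<tau> + 1)" by (simp add: \<sigma>)
  finally show ?thesis unfolding norm_minus_cancel .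
qed

section \<open>The eta quotient of a prime level\<close>

lemma ee_sum: "finite A \<Longrightarrow> ee (sum f A) = (\<Prod>a\<in>A. ee (f a))"
  unfolding ee_def sum_distrib_left by (rule exp_sum)

text \<open>The two products of the \<open>a\<close>-th Klein form belong to the residues
  \<open>a\<close> and \<open>p - a\<close>. Together they run over all nonzero residues modulo
  \<open>p\<close>, and the root of unity identity applies once residue 0 is added.\<close>

lemma prod_klein_form_torsion:
  assumes "p = 2 * m + 1"
  obtains C where "C \<noteq> 0" "\<And>\<tau>. Im \<tau> > 0 \<Longrightarrow>
    (\<Prod>a = 1..m. klein_form 0 (of_nat a / of_nat p) \<tau>) = C * (dedekind_eta (of_nat p * \<tau>) / dedekind_eta \<tau> ^ p)"
proof -
  have p: "p > 0" using assms by simp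
  \<comment> \<open>The part of the Klein form independent of \<tau>, including the leading factor
    split off by \<open>qpoch_rec\<close>.\<close>
  define c where "c = (\<lambda>a::nat. \<i> / (2 * of_real pi) * ee (- (of_nat a / of_nat p) / 2) * (1 - ee (of_nat a / of_nat p)))"
  have c_nz: "c a \<noteq> 0" if "a \<in> {1..m}" for a
  proof -
    have "ee (of_nat a / of_nat p) \<noteq> 1"
    proof
      assume "ee (of_nat a / of_nat p) = 1"
      then obtain n :: int where "of_nat a / of_nat p = (of_int n :: complex)" by (auto simp: ee_eq_1_iff)
      hence "of_int (int a) = (of_int (n * int p) :: complex)" using p by (simp add: field_simps)
      hence "int a = n * int p" by (simp only: of_int_eq_iff)
      hence "p dvd a" by (metis dvd_triv_right int_dvd_int_iff)
      thus False using that assms by (auto dest: dvd_imp_le)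
    qed
    thus ?thesis by (simp add: c_def)
  qed
  show ?thesis
  proof (rule that[of "\<Prod>a = 1..m. c a"])
    show "(\<Prod>a = 1..m. c a) \<noteq> 0" using c_nz by simp
    fix \<tau> :: complex assume \<tau>: "Im \<tau> > 0"
    define q where "q = ee \<tau>"
    have q: "norm q < 1" unfolding q_def by (rule norm_ee_less_1[OF \<tau>])
    have nz: "qpoch q q \<noteq> 0" by (rule qpoch_nonzero[OF q q])
    define G where "G = (\<lambda>a::nat. qpoch (q * ee (of_nat a / of_nat p)) q)"
    have klein: "klein_form 0 (of_nat a / of_nat p) \<tau> = c a * (G a * G (p - a)) / qpoch q q ^ 2"
      if "a \<in> {1..m}" for a
    proof -
      have "a \<le> p" using that assms by simp
      have "qpoch (ee (of_nat a / of_nat p)) q = (1 - ee (of_nat a / of_nat p)) * G a"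
        using qpoch_rec[OF q, of "ee (of_nat a / of_nat p)"] by (simp add: G_def mult_ac)
      moreover have "(of_nat (p - a) :: complex) / of_nat p = 1 - of_nat a / of_nat p"
        using \<open>a \<le> p\<close> p by (simp add: of_nat_diff diff_divide_distrib)
      hence "qpoch (ee (\<tau> - of_nat a / of_nat p)) q = G (p - a)"
        by (simp add: G_def ee_diff q_def)
      ultimately show ?thesis
        by (simp add: klein_form_def theta_ratio_def c_def flip: q_def)
    qed
    have "(\<Prod>a = 1..m. G a * G (p - a)) = (\<Prod>a = 1..m. G a) * (\<Prod>a = m + 1..2 * m. G a)"
    proof -
      have "(\<Prod>a = 1..m. G (p - a)) = (\<Prod>a = m + 1..2 * m. G a)"
        by (rule prod.reindex_bij_witness[of _ "\<lambda>a. p - a" "\<lambda>a. p - a"]) (auto simp: assms)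
      thus ?thesis by (simp add: prod.distrib)
    qed
    also have "\<dots> = (\<Prod>a = 1..2 * m. G a)"
      by (subst prod.union_disjoint[symmetric]) (auto intro!: prod.cong)
    \<comment> \<open>Residue 0 contributes the Euler product \<open>qpoch q q\<close>
      itself.\<close>
    also have "G 0 * \<dots> = (\<Prod>a<p. G a)"
    proof -
      have "{..<p} = insert 0 {1..2 * m}" using assms by auto
      thus ?thesis by simp
    qed
    also have "\<dots> = qpoch (q ^ p) (q ^ p)"
      using prod_qpoch_roots_of_unity[OF q p, of q] by (simp add: G_def ee_def)
    finally have prodG: "qpoch q q * (\<Prod>a = 1..m. G a * G (p - a)) = qpoch (q ^ p) (q ^ p)"
      by (simp add: G_def)
    have eta_p: "dedekind_eta (of_nat p * \<tau>) = ee (\<tau> / 24) ^ p * qpoch (q ^ p) (q ^ p)"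
      by (simp add: dedekind_eta_eq ee_of_nat_mult q_def flip: times_divide_eq_right)
    have "(\<Prod>a = 1..m. klein_form 0 (of_nat a / of_nat p) \<tau>) =
        (\<Prod>a = 1..m. c a) * ((\<Prod>a = 1..m. G a * G (p - a)) / (qpoch q q ^ 2) ^ m)"
      by (simp add: klein prod.distrib prod_dividef)
    also have "(\<Prod>a = 1..m. G a * G (p - a)) / (qpoch q q ^ 2) ^ m = qpoch (q ^ p) (q ^ p) / qpoch q q ^ p"
    proof -
      \<comment> \<open>One of the \<open>p\<close> Euler factors comes from residue 0, the other
        \<open>2 * m\<close> from the denominators of the Klein forms.\<close>
      have "qpoch q q ^ p = qpoch q q * (qpoch q q ^ 2) ^ m" by (simp add: assms power_mult)
      thus ?thesis unfolding prodG[symmetric] using nz by simp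
    qed
    also have "\<dots> = dedekind_eta (of_nat p * \<tau>) / dedekind_eta \<tau> ^ p"
      unfolding eta_p by (simp add: dedekind_eta_eq power_mult_distrib flip: q_def)
    finally show "(\<Prod>a = 1..m. klein_form 0 (of_nat a / of_nat p) \<tau>) =
        (\<Prod>a = 1..m. c a) * (dedekind_eta (of_nat p * \<tau>) / dedekind_eta \<tau> ^ p)" .
  qed
qed

lemma sum_nat_squares_complex:
  "(\<Sum>a = 1..m. of_nat a) * 2 = (of_nat (m * (m + 1)) :: complex)"
  "(\<Sum>a = 1..m. of_nat a ^ 2) * 6 = (of_nat (m * (m + 1) * (2 * m + 1)) :: complex)"
  by (induction m) (simp_all add: algebra_simps power2_eq_square)

text \<open>A matrix in \<open>Gamma1 p\<close> fixes each characteristic (0, n/p) modulo integers,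
  so the product of Klein forms changes only by an automorphy factor and a root of unity. The
  hypotheses on \<open>p\<close> make that root of unity 1.\<close>

theorem eta_power_over_eta_Gamma1:
  assumes p: "odd p" "\<not> 3 dvd p" and A: "(a, b, c, d) \<in> Gamma1 p" and \<tau>: "Im \<tau> > 0"
  shows "dedekind_eta (moebius (a, b, c, d) \<tau>) ^ p / dedekind_eta (of_nat p * moebius (a, b, c, d) \<tau>) =
    (of_int c * \<tau> + of_int d) ^ ((p - 1) div 2) * (dedekind_eta \<tau> ^ p / dedekind_eta (of_nat p * \<tau>))"
proof -
  from p obtain m where m: "p = 2 * m + 1" by (elim oddE)
  have "p > 0" using m by simp
  have SL: "(a, b, c, d) \<in> SL2Z" using A by (simp add: Gamma1_def)
  define J where "J = of_int c * \<tau> + of_int d"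
  have J: "J \<noteq> 0" unfolding J_def by (rule automorphy_factor_nonzero[OF SL \<tau>])
  define w where "w = moebius (a, b, c, d) \<tau>"
  have w: "Im w > 0" unfolding w_def by (rule Im_moebius_pos[OF SL \<tau>])
  obtain c' where c': "c = int p * c'" using A by (auto simp: Gamma1_def cong_0_iff)
  obtain d' where "d - 1 = int p * d'" using A by (auto simp: Gamma1_def cong_iff_dvd_diff)
  hence d': "d = 1 + int p * d'" by simp
  \<comment> \<open>\<open>X n\<close> gathers the exponents of the quasi-periodicity factors for
    the characteristic \<open>(n c', n / p + n d')\<close>.\<close>
  define X :: "nat \<Rightarrow> complex" where
    "X = (\<lambda>n. (of_nat n * of_int (c' + d') - of_nat n ^ 2 * of_int (c' * d')) / 2 - of_nat n ^ 2 * of_int c' / (2 * of_nat p))"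
  have klein: "klein_form 0 (of_nat n / of_nat p) w = ee (X n) * klein_form 0 (of_nat n / of_nat p) \<tau> / J" for n
  proof -
    define v :: complex where "v = of_nat n / of_nat p"
    have neg: "- ee (- y / 2) = ee (1 / 2 - y / 2)" for y
      using ee_diff[of "1 / 2" "y / 2"] ee_minus[of "y / 2"] by (simp add: inverse_eq_divide)
    have "klein_form 0 v w = klein_form (v * of_int c) (v * of_int d) \<tau> / J"
      using klein_form_moebius[OF SL \<tau>, of 0 v] by (simp add: w_def J_def)
    also have "v * of_int c = of_int (int n * c')" using \<open>p > 0\<close> by (simp add: v_def c')
    also have "v * of_int d = v + of_int (int n * d')" using \<open>p > 0\<close> by (simp add: v_def d' field_simps)
    also have "klein_form (of_int (int n * c')) (v + of_int (int n * d')) \<tau> =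
        (- ee (- (v + of_int (int n * d')) / 2)) powi (int n * c') * ((- 1) powi (int n * d') * klein_form 0 v \<tau>)"
      by (simp only: klein_form_of_int[OF \<tau>] klein_form_0_add_int)
    also have "- ee (- (v + of_int (int n * d')) / 2) = ee (1 / 2 - (v + of_int (int n * d')) / 2)"
      by (rule neg)
    also have "\<dots> powi (int n * c') = ee (of_int (int n * c') * (1 / 2 - (v + of_int (int n * d')) / 2))"
      by (rule ee_of_int_mult[symmetric])
    also have "(- 1 :: complex) powi (int n * d') = ee (of_int (int n * d') * (1 / 2))"
      by (subst ee_of_int_mult) simp
    also have "ee (of_int (int n * c') * (1 / 2 - (v + of_int (int n * d')) / 2)) * (ee (of_int (int n * d') * (1 / 2)) * klein_form 0 v \<tau>)
       = ee (of_int (int n * c') * (1 / 2 - (v + of_int (int n * d')) / 2) + of_int (int n * d') * (1 / 2)) * klein_form 0 v \<tau>"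
      by (simp add: ee_add)
    also have "of_int (int n * c') * (1 / 2 - (v + of_int (int n * d')) / 2) + of_int (int n * d') * (1 / 2) = X n"
      using \<open>p > 0\<close> by (simp add: X_def v_def field_simps power2_eq_square)
    finally show ?thesis unfolding v_def .
  qed
  \<comment> \<open>Here \<open>\<not> 3 dvd p\<close> enters, since \<open>m mod 3 = 1\<close>
    would make \<open>2 * m + 1\<close> a multiple of 3. It also makes the sum of squares divisible
    by \<open>p\<close>, which removes the denominator of \<open>X\<close>.\<close>
  have "6 dvd m * (m + 1)"
  proof -
    have "m mod 3 \<noteq> 1" using p(2) m by presburger
    hence "3 dvd m \<or> 3 dvd m + 1" by presburger
    hence "3 dvd m * (m + 1)" by (metis dvd_mult dvd_mult2)
    moreover have "2 dvd m * (m + 1)" by simp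
    moreover have "6 dvd x" if "3 dvd x" "2 dvd x" for x :: nat
      using that by presburger
    ultimately show ?thesis by blast
  qed
  then obtain M where M: "m * (m + 1) = 6 * M" by (elim dvdE)
  have S1: "(\<Sum>n = 1..m. of_nat n) = (3 * of_nat M :: complex)"
    using sum_nat_squares_complex(1)[of m] unfolding M by simp
  have S2: "(\<Sum>n = 1..m. of_nat n ^ 2) = (of_nat M * of_nat p :: complex)"
    using sum_nat_squares_complex(2)[of m] unfolding M m[symmetric] by simp
  have "(\<Sum>n = 1..m. X n) = ((\<Sum>n = 1..m. of_nat n) * of_int (c' + d') - (\<Sum>n = 1..m. of_nat n ^ 2) * of_int (c' * d')) / 2
      - (\<Sum>n = 1..m. of_nat n ^ 2) * of_int c' / (2 * of_nat p)"
    unfolding X_def by (simp add: sum_subtractf sum_divide_distrib sum_distrib_right diff_divide_distrib)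
  also have "\<dots> = of_int (int M * (2 * c' + d' * (3 - int p * c'))) / 2"
    using \<open>p > 0\<close> unfolding S1 S2 by (simp add: field_simps)
  finally have sumX: "(\<Sum>n = 1..m. X n) = of_int (int M * (2 * c' + d' * (3 - int p * c'))) / 2" .
  \<comment> \<open>Only a denominator 2 remains. If the product were odd, \<open>c\<close> and
    \<open>d\<close> would both be even, against determinant 1.\<close>
  have "even (d' * (3 - int p * c'))"
  proof (rule ccontr)
    assume "odd (d' * (3 - int p * c'))"
    hence "odd d'" "even c'" using p by auto
    hence "even d" "even c" using p by (simp_all add: c' d')
    hence "even (a * d - b * c)" by simp
    moreover have "a * d - b * c = 1" using SL by (simp add: SL2Z_def)
    ultimately show False by (metis odd_one)
  qed
  then obtain l where l: "d' * (3 - int p * c') = 2 * l" by (elim evenE)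
  have "(\<Sum>n = 1..m. X n) = of_int (int M * (c' + l))" unfolding sumX l by (simp add: field_simps)
  hence "(\<Prod>n = 1..m. ee (X n)) = 1" by (simp only: ee_sum[symmetric] finite_atLeastAtMost ee_of_int)
  hence prod: "(\<Prod>n = 1..m. klein_form 0 (of_nat n / of_nat p) w) = (\<Prod>n = 1..m. klein_form 0 (of_nat n / of_nat p) \<tau>) / J ^ m"
    by (simp add: klein prod_dividef prod.distrib)
  obtain C where C: "C \<noteq> 0" "\<And>\<tau>. Im \<tau> > 0 \<Longrightarrow>
    (\<Prod>a = 1..m. klein_form 0 (of_nat a / of_nat p) \<tau>) = C * (dedekind_eta (of_nat p * \<tau>) / dedekind_eta \<tau> ^ p)"
    using prod_klein_form_torsion[OF m] by metis
  have "dedekind_eta (of_nat p * w) / dedekind_eta w ^ p = dedekind_eta (of_nat p * \<tau>) / dedekind_eta \<tau> ^ p / J ^ m"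
    using prod unfolding C(2)[OF w] C(2)[OF \<tau>] times_divide_eq_right[symmetric] mult_left_cancel[OF C(1)] .
  hence "inverse (dedekind_eta (of_nat p * w) / dedekind_eta w ^ p) = inverse (dedekind_eta (of_nat p * \<tau>) / dedekind_eta \<tau> ^ p / J ^ m)"
    by (rule arg_cong)
  hence "dedekind_eta w ^ p / dedekind_eta (of_nat p * w) = J ^ m * (dedekind_eta \<tau> ^ p / dedekind_eta (of_nat p * \<tau>))"
    by (simp add: field_simps)
  thus ?thesis by (simp add: w_def J_def m)
qed

section \<open>Growth of eta quotients\<close>

text \<open>In the factorization of \<open>1 - r ^ n\<close> by \<open>1 - r\<close>, each of the
  \<open>n\<close> summands is at least \<open>r ^ (n - 1)\<close>.\<close>

lemma power_over_one_minus_power_le: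
  fixes r :: real
  assumes "0 < r" "r < 1" "n > 0"
  shows "r ^ n / (1 - r ^ n) \<le> r / (1 - r) / real n"
proof -
  have rn: "r ^ n < 1" using assms by (simp add: power_less_one_iff)
  have "real n * r ^ (n - 1) = (\<Sum>i<n. r ^ (n - 1))" by simp
  also have "\<dots> \<le> (\<Sum>i<n. r ^ i)"
    using assms by (intro sum_mono power_decreasing) auto
  finally have "(1 - r) * (real n * r ^ (n - 1)) \<le> 1 - r ^ n"
    using assms unfolding one_diff_power_eq by (intro mult_left_mono) auto
  hence "r * ((1 - r) * (real n * r ^ (n - 1))) \<le> r * (1 - r ^ n)"
    using assms by (intro mult_left_mono) auto
  moreover have "r * ((1 - r) * (real n * r ^ (n - 1))) = r ^ n * ((1 - r) * real n)"
    using assms by (cases n) auto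
  ultimately have "r ^ n * ((1 - r) * real n) \<le> r * (1 - r ^ n)" by linarith
  thus ?thesis using assms rn by (simp add: divide_simps mult_ac)
qed

text \<open>This is zeta(2): the term at index 0 vanishes because
  \<open>inverse 0 = 0\<close>.\<close>

definition inverse_square_sum :: real where
  "inverse_square_sum = (\<Sum>n. inverse (real n ^ 2))"

lemma inverse_square_sum_nonneg: "inverse_square_sum \<ge> 0"
  unfolding inverse_square_sum_def by (intro suminf_nonneg inverse_power_summable) auto

text \<open>Expanding the logarithms gives \<open>- ln (\<Prod>k. 1 - r\<^bsup>k + 1\<^esup>) = (\<Sum>n. r\<^sup>n / (n (1 - r\<^sup>n)))\<close>. This
  is \<open>O(1 / (1 - r))\<close>, which keeps the growth of eta quotients at the cusps exponential.\<close>

lemma prod_one_minus_power_ge: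
  fixes r :: real
  assumes "0 < r" "r < 1"
  shows "(\<Prod>k<N. 1 - r ^ Suc k) \<ge> exp (- (inverse_square_sum * (r / (1 - r))))"
proof -
  have rk: "r ^ Suc k < 1" for k using assms by (simp only: power_less_one_iff) auto
  have "(\<lambda>n. \<Sum>k<N. (r ^ Suc k) ^ n / of_nat n) sums (\<Sum>k<N. - ln (1 - r ^ Suc k))"
  proof (intro sums_sum)
    fix k
    have "\<bar>- (r ^ Suc k)\<bar> < 1" using rk[of k] assms by (simp add: abs_mult)
    from sums_minus[OF ln_series'[OF this]]
    show "(\<lambda>n. (r ^ Suc k) ^ n / of_nat n) sums (- ln (1 - r ^ Suc k))" by simp
  qed
  moreover have "(\<lambda>n. r / (1 - r) * inverse (real n ^ 2)) sums (r / (1 - r) * inverse_square_sum)"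
    unfolding inverse_square_sum_def by (intro sums_mult summable_sums inverse_power_summable) simp
  \<comment> \<open>With the order of summation exchanged, the sum over \<open>k\<close> is
    geometric. The factor 1/n of the logarithm and that of
    \<open>power_over_one_minus_power_le\<close> produce the inverse square.\<close>
  moreover have "(\<Sum>k<N. (r ^ Suc k) ^ n / of_nat n) \<le> r / (1 - r) * inverse (real n ^ 2)" for n
  proof (cases "n = 0")
    case False
    have rn: "r ^ n < 1" using assms False by (simp add: power_less_one_iff)
    have "(\<Sum>k<N. (r ^ Suc k) ^ n) = r ^ n * (\<Sum>k<N. (r ^ n) ^ k)"
      unfolding sum_distrib_left by (intro sum.cong refl) (simp add: power_mult_distrib mult.commute flip: power_mult)
    also have "(\<Sum>k<N. (r ^ n) ^ k) \<le> 1 / (1 - r ^ n)"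
    proof -
      have "(1 - r ^ n) * (\<Sum>k<N. (r ^ n) ^ k) \<le> 1"
        unfolding one_diff_power_eq[symmetric] using assms by simp
      thus ?thesis using rn by (simp add: pos_le_divide_eq mult.commute)
    qed
    finally have "(\<Sum>k<N. (r ^ Suc k) ^ n) \<le> r ^ n / (1 - r ^ n)" using assms by simp
    also have "\<dots> \<le> r / (1 - r) / real n"
      using power_over_one_minus_power_le[OF assms, of n] False by simp
    finally have "(\<Sum>k<N. (r ^ Suc k) ^ n) / real n \<le> r / (1 - r) / real n / real n"
      by (intro divide_right_mono) auto
    thus ?thesis
      unfolding sum_divide_distrib[symmetric] by (simp add: divide_inverse power2_eq_square mult_ac)
  qed simp
  ultimately have "(\<Sum>k<N. - ln (1 - r ^ Suc k)) \<le> r / (1 - r) * inverse_square_sum"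
    by (rule sums_le[rotated])
  hence "exp (- (inverse_square_sum * (r / (1 - r)))) \<le> exp (\<Sum>k<N. ln (1 - r ^ Suc k))"
    by (simp add: sum_negf mult.commute)
  also have "\<dots> = (\<Prod>k<N. 1 - r ^ Suc k)"
    using rk by (subst exp_sum) (auto intro!: prod.cong)
  finally show ?thesis .
qed

text \<open>For r = |q| each factor lies between 1 - r^k and 1 + r^k, and the latter is at most 1 /
  (1 - r^k), so one estimate serves both sides. Finally r / (1 - r) = 1 / (exp (2 pi y) - 1) is at
  most 1/y for \<open>y = Im \<tau>\<close>.\<close>

lemma norm_euler_product_bounds:
  assumes "Im \<tau> > 0"
  shows "exp (- (inverse_square_sum / Im \<tau>)) \<le> norm (qpoch (ee \<tau>) (ee \<tau>))"
    and "norm (qpoch (ee \<tau>) (ee \<tau>)) \<le> exp (inverse_square_sum / Im \<tau>)"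
proof -
  define r where "r = norm (ee \<tau>)"
  have r: "0 < r" "r < 1" using norm_ee_less_1[OF assms] by (auto simp: r_def)
  define E where "E = exp (- (inverse_square_sum * (r / (1 - r))))"
  have "r / (1 - r) \<le> 1 / Im \<tau>"
  proof -
    have e: "exp (2 * pi * Im \<tau>) \<ge> 1 + 2 * pi * Im \<tau>" by (rule exp_ge_add_one_self)
    have "r = 1 / exp (2 * pi * Im \<tau>)" by (simp add: r_def norm_ee exp_minus field_simps)
    moreover have "(1 / x) / (1 - 1 / x) = 1 / (x - 1)" if "x > 1" for x :: real
      using that by (simp add: field_simps)
    ultimately have "r / (1 - r) = 1 / (exp (2 * pi * Im \<tau>) - 1)" using assms by simp
    also have "\<dots> \<le> 1 / Im \<tau>"
    proof (rule divide_left_mono)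
      have "1 * Im \<tau> \<le> (2 * pi) * Im \<tau>" using assms pi_gt3 by (intro mult_right_mono) auto
      thus "Im \<tau> \<le> exp (2 * pi * Im \<tau>) - 1" using e by linarith
      thus "0 < (exp (2 * pi * Im \<tau>) - 1) * Im \<tau>" using assms by simp
    qed simp
    finally show ?thesis .
  qed
  hence *: "inverse_square_sum * (r / (1 - r)) \<le> inverse_square_sum / Im \<tau>"
    using mult_left_mono[OF _ inverse_square_sum_nonneg] by fastforce
  have lim: "(\<lambda>n. norm (\<Prod>k<n. 1 - ee \<tau> * ee \<tau> ^ k)) \<longlonglongrightarrow> norm (qpoch (ee \<tau>) (ee \<tau>))"
    unfolding qpoch_def using norm_ee_less_1[OF assms]
    by (intro tendsto_norm has_prod_imp_tendsto' convergent_prod_has_prod convergent_prod_qpoch)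
  have rk: "r ^ Suc k < 1" for k using r by (simp only: power_less_one_iff) auto
  have n: "norm (ee \<tau> * ee \<tau> ^ k) = r ^ Suc k" for k by (simp add: norm_mult norm_power r_def)
  have ge: "E \<le> norm (\<Prod>k<n. 1 - ee \<tau> * ee \<tau> ^ k)" for n
  proof -
    have "E \<le> (\<Prod>k<n. 1 - r ^ Suc k)" unfolding E_def by (rule prod_one_minus_power_ge[OF r])
    also have "\<dots> \<le> (\<Prod>k<n. norm (1 - ee \<tau> * ee \<tau> ^ k))"
    proof (rule prod_mono)
      fix k show "0 \<le> 1 - r ^ Suc k \<and> 1 - r ^ Suc k \<le> norm (1 - ee \<tau> * ee \<tau> ^ k)"
        using rk[of k] n[of k] norm_triangle_ineq2[of 1 "ee \<tau> * ee \<tau> ^ k"] by simp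
    qed
    finally show ?thesis by (simp add: prod_norm)
  qed
  have le: "norm (\<Prod>k<n. 1 - ee \<tau> * ee \<tau> ^ k) \<le> inverse E" for n
  proof -
    have "norm (\<Prod>k<n. 1 - ee \<tau> * ee \<tau> ^ k) = (\<Prod>k<n. norm (1 - ee \<tau> * ee \<tau> ^ k))"
      by (simp add: prod_norm)
    also have "\<dots> \<le> (\<Prod>k<n. inverse (1 - r ^ Suc k))"
    proof (rule prod_mono)
      fix k
      have "norm (1 - ee \<tau> * ee \<tau> ^ k) \<le> 1 + r ^ Suc k"
        using norm_triangle_ineq4[of 1 "ee \<tau> * ee \<tau> ^ k"] n[of k] by simp
      also have "(1 + r ^ Suc k) * (1 - r ^ Suc k) \<le> 1"
        using r by (simp add: algebra_simps del: power_Suc)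
      hence "1 + r ^ Suc k \<le> inverse (1 - r ^ Suc k)"
        using rk[of k] by (simp add: field_simps del: power_Suc)
      finally show "0 \<le> norm (1 - ee \<tau> * ee \<tau> ^ k) \<and> norm (1 - ee \<tau> * ee \<tau> ^ k) \<le> inverse (1 - r ^ Suc k)"
        by simp
    qed
    also have "\<dots> = inverse (\<Prod>k<n. 1 - r ^ Suc k)" by (simp add: prod_inversef[symmetric] o_def)
    also have "\<dots> \<le> inverse E"
      using prod_one_minus_power_ge[OF r] by (intro le_imp_inverse_le) (auto simp: E_def)
    finally show ?thesis .
  qed
  have "E \<le> norm (qpoch (ee \<tau>) (ee \<tau>))"
    by (rule LIMSEQ_le_const[OF lim]) (use ge in auto)
  moreover have "exp (- (inverse_square_sum / Im \<tau>)) \<le> E" unfolding E_def using * by simp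
  ultimately show "exp (- (inverse_square_sum / Im \<tau>)) \<le> norm (qpoch (ee \<tau>) (ee \<tau>))" by simp
  have "norm (qpoch (ee \<tau>) (ee \<tau>)) \<le> inverse E"
    by (rule LIMSEQ_le_const2[OF lim]) (use le in auto)
  moreover have "inverse E \<le> exp (inverse_square_sum / Im \<tau>)"
    unfolding E_def using * by (simp add: exp_minus)
  ultimately show "norm (qpoch (ee \<tau>) (ee \<tau>)) \<le> exp (inverse_square_sum / Im \<tau>)" by simp
qed

text \<open>Bounds symmetric under inversion allow exponents of either sign, as eta quotients
  require.\<close>

lemma norm_powi_le_exp:
  fixes x :: complex
  assumes "exp (- B) \<le> norm x" "norm x \<le> exp B"
  shows "norm (x powi n) \<le> exp (of_int \<bar>n\<bar> * B)"
proof (cases "n \<ge> 0")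
  case True
  have "norm (x powi n) = norm x ^ nat n" using True by (simp add: power_int_def norm_power)
  also have "\<dots> \<le> exp B ^ nat n" using assms by (intro power_mono) auto
  also have "\<dots> = exp (of_int \<bar>n\<bar> * B)" using True by (simp flip: exp_of_nat_mult)
  finally show ?thesis .
next
  case False
  have "inverse (norm x) \<le> inverse (exp (- B))" using assms by (intro le_imp_inverse_le) auto
  hence "inverse (norm x) ^ nat (- n) \<le> exp B ^ nat (- n)"
    by (intro power_mono) (auto simp: exp_minus)
  also have "\<dots> = exp (of_int \<bar>n\<bar> * B)" using False by (simp flip: exp_of_nat_mult)
  finally show ?thesis using False by (simp add: power_int_def norm_power norm_inverse)
qed

lemma norm_dedekind_eta_powi_le:
  assumes "Im \<tau> > 0"
  shows "norm (dedekind_eta \<tau> powi n) \<le> exp (of_int \<bar>n\<bar> * ((inverse_square_sum + 1) * (Im \<tau> + 1 / Im \<tau>)))"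
proof (rule norm_powi_le_exp)
  define S where "S = inverse_square_sum"
  define y where "y = Im \<tau>"
  have S: "S \<ge> 0" and y: "y > 0" using inverse_square_sum_nonneg assms by (auto simp: S_def y_def)
  have eta: "norm (dedekind_eta \<tau>) = exp (- (pi * y / 12)) * norm (qpoch (ee \<tau>) (ee \<tau>))"
    by (simp add: dedekind_eta_eq norm_mult norm_ee y_def)
  \<comment> \<open>The summand 1 in the constant absorbs the prefactor
    \<open>ee (\<tau> / 24)\<close>, whose decay rate pi/12 is below 1.\<close>
  have "pi * y / 12 \<le> y" using y pi_less_4 by simp
  moreover have "(S + 1) * (y + 1 / y) = S * y + y + S / y + 1 / y" by (simp add: algebra_simps add_divide_distrib)
  moreover have "S * y \<ge> 0" "S / y \<ge> 0" "1 / y \<ge> 0" using S y by auto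
  ultimately have B: "pi * y / 12 + S / y \<le> (S + 1) * (y + 1 / y)" "S / y \<le> (S + 1) * (y + 1 / y)"
    using y by linarith+
  have "exp (- ((S + 1) * (y + 1 / y))) \<le> exp (- (pi * y / 12) + - (S / y))"
    unfolding exp_le_cancel_iff using B(1) by linarith
  also have "\<dots> \<le> norm (dedekind_eta \<tau>)"
    unfolding eta exp_add S_def y_def using norm_euler_product_bounds(1)[OF assms] by (intro mult_left_mono) auto
  finally show "exp (- ((inverse_square_sum + 1) * (Im \<tau> + 1 / Im \<tau>))) \<le> norm (dedekind_eta \<tau>)"
    by (simp add: S_def y_def)
  have "norm (dedekind_eta \<tau>) \<le> 1 * exp (S / y)"
    unfolding eta S_def using norm_euler_product_bounds(2)[OF assms] y by (intro mult_mono) (auto simp: y_def)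
  also have "\<dots> \<le> exp ((S + 1) * (y + 1 / y))" using B(2) by simp
  finally show "norm (dedekind_eta \<tau>) \<le> exp ((inverse_square_sum + 1) * (Im \<tau> + 1 / Im \<tau>))"
    by (simp add: S_def y_def)
qed

lemma norm_eta_quotient_le:
  assumes "N > 0"
  obtains K where "K \<ge> 0" "\<And>\<tau>. Im \<tau> > 0 \<Longrightarrow> norm (eta_quotient N r \<tau>) \<le> exp (K * (Im \<tau> + 1 / Im \<tau>))"
proof
  define S where "S = inverse_square_sum + 1"
  have S: "S \<ge> 0" using inverse_square_sum_nonneg by (simp add: S_def)
  show "(\<Sum>\<delta> | \<delta> dvd N. of_int \<bar>r \<delta>\<bar> * S * real \<delta>) \<ge> 0"
    using S by (intro sum_nonneg) auto
  fix \<tau> :: complex assume \<tau>: "Im \<tau> > 0"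
  define y where "y = Im \<tau>"
  have y: "y > 0" using \<tau> by (simp add: y_def)
  have fin: "finite {\<delta>. \<delta> dvd N}" using assms by simp
  have "norm (eta_quotient N r \<tau>) = (\<Prod>\<delta> | \<delta> dvd N. norm (dedekind_eta (of_nat \<delta> * \<tau>) powi r \<delta>))"
    by (simp add: eta_quotient_def prod_norm)
  also have "\<dots> \<le> (\<Prod>\<delta> | \<delta> dvd N. exp (of_int \<bar>r \<delta>\<bar> * S * real \<delta> * (y + 1 / y)))"
  proof (rule prod_mono)
    fix \<delta> assume "\<delta> \<in> {\<delta>. \<delta> dvd N}"
    hence \<delta>: "\<delta> \<ge> 1" using assms by (auto intro: Suc_leI dvd_pos_nat)
    hence im: "Im (of_nat \<delta> * \<tau>) = real \<delta> * y" "Im (of_nat \<delta> * \<tau>) > 0" using \<tau> by (simp_all add: y_def)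
    have "1 / (real \<delta> * y) \<le> real \<delta> / y"
      using \<delta> y mult_mono[of 1 "real \<delta>" 1 "real \<delta>"] by (simp add: divide_simps)
    hence "real \<delta> * y + 1 / (real \<delta> * y) \<le> real \<delta> * (y + 1 / y)" by (simp add: algebra_simps)
    hence "of_int \<bar>r \<delta>\<bar> * S * (real \<delta> * y + 1 / (real \<delta> * y)) \<le> of_int \<bar>r \<delta>\<bar> * S * (real \<delta> * (y + 1 / y))"
      using S by (intro mult_left_mono) auto
    moreover have "norm (dedekind_eta (of_nat \<delta> * \<tau>) powi r \<delta>) \<le> exp (of_int \<bar>r \<delta>\<bar> * S * (real \<delta> * y + 1 / (real \<delta> * y)))"
      using norm_dedekind_eta_powi_le[OF im(2), of "r \<delta>"] unfolding im(1) by (simp only: S_def mult.assoc)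
    ultimately have "norm (dedekind_eta (of_nat \<delta> * \<tau>) powi r \<delta>) \<le> exp (of_int \<bar>r \<delta>\<bar> * S * (real \<delta> * (y + 1 / y)))"
      by (meson exp_le_cancel_iff order_trans)
    thus "0 \<le> norm (dedekind_eta (of_nat \<delta> * \<tau>) powi r \<delta>) \<and>
        norm (dedekind_eta (of_nat \<delta> * \<tau>) powi r \<delta>) \<le> exp (of_int \<bar>r \<delta>\<bar> * S * real \<delta> * (y + 1 / y))"
      by (simp only: mult.assoc norm_ge_zero simp_thms)
  qed
  also have "\<dots> = exp ((\<Sum>\<delta> | \<delta> dvd N. of_int \<bar>r \<delta>\<bar> * S * real \<delta>) * (y + 1 / y))"
    by (simp only: exp_sum[OF fin] sum_distrib_right)
  finally show "norm (eta_quotient N r \<tau>) \<le> exp ((\<Sum>\<delta> | \<delta> dvd N. of_int \<bar>r \<delta>\<bar> * S * real \<delta>) * (Im \<tau> + 1 / Im \<tau>))"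
    by (simp only: y_def)
qed

section \<open>Meromorphy at the cusps\<close>

text \<open>Periodicity lets \<open>F\<close> descend along a logarithm to the punctured disc. The
  growth bound, needed only where the principal logarithm lands, says that a power of the local
  parameter removes the singularity.\<close>

lemma periodic_meromorphic_at_infinity:
  assumes N: "N > 0" and hol: "F holomorphic_on {\<tau>. Im \<tau> > 0}"
    and per: "\<And>\<tau>. Im \<tau> > 0 \<Longrightarrow> F (\<tau> + of_nat N) = F \<tau>"
    and bound: "\<And>\<tau>. Im \<tau> \<ge> 1 \<Longrightarrow> \<bar>Re \<tau>\<bar> \<le> real N \<Longrightarrow> norm (F \<tau>) \<le> exp (M * Im \<tau>)"
  obtains g where "g meromorphic_on {0}"
    "\<And>\<tau>. Im \<tau> > 0 \<Longrightarrow> F \<tau> = g (exp (2 * of_real pi * \<i> * \<tau> / of_nat N))"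
proof -
  \<comment> \<open>\<open>L\<close> inverts the substitution \<xi> = 2 pi \<i> \<tau> / N.\<close>
  define L where "L = (\<lambda>\<xi>. of_nat N * \<xi> / (2 * of_real pi * \<i>))"
  have ImL: "Im (L \<xi>) = - (real N * Re \<xi> / (2 * pi))" and ReL: "Re (L \<xi>) = real N * Im \<xi> / (2 * pi)" for \<xi>
    by (simp_all add: L_def Im_divide Re_divide field_simps power2_eq_square)
  have per_int: "F (\<tau> + of_int n * of_nat N) = F \<tau>" if "Im \<tau> > 0" for \<tau> and n :: int
  proof (induction n rule: int_induct[of _ 0])
    case (step1 i)
    show ?case using per[of "\<tau> + of_int i * of_nat N"] step1 that by (simp add: algebra_simps)
  next
    case (step2 i)
    show ?case using per[of "\<tau> + of_int (i - 1) * of_nat N"] step2 that by (simp add: algebra_simps)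
  qed simp
  have ImL_pos: "Im (L \<xi>) > 0" if "Re \<xi> < 0" for \<xi>
    using that N by (simp add: ImL divide_neg_pos mult_pos_neg)
  define g where "g = (\<lambda>w. F (L (Ln w)))"
  have g_exp: "g (exp \<xi>) = F (L \<xi>)" if "Re \<xi> < 0" for \<xi>
  proof -
    have "exp (Ln (exp \<xi>)) = exp \<xi>" by simp
    then obtain n :: int where "Ln (exp \<xi>) = \<xi> + of_real (of_int (2 * n) * pi) * \<i>"
      unfolding exp_eq by blast
    hence "L (Ln (exp \<xi>)) = L \<xi> + of_int n * of_nat N" by (simp add: L_def field_simps)
    thus ?thesis unfolding g_def using per_int ImL_pos[OF that] by simp
  qed
  have Re_Ln_neg: "Re (Ln w) < 0" if "w \<noteq> 0" "norm w < 1" for w using that by simp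
  have holFL: "(\<lambda>w. F (L (\<xi> w))) holomorphic_on U"
    if "\<xi> holomorphic_on U" "\<And>w. w \<in> U \<Longrightarrow> Re (\<xi> w) < 0" for \<xi> U
  proof -
    have "(\<lambda>w. L (\<xi> w)) holomorphic_on U" unfolding L_def using that by (intro holomorphic_intros) auto
    moreover have "(\<lambda>w. L (\<xi> w)) ` U \<subseteq> {\<tau>. Im \<tau> > 0}" using that ImL_pos by auto
    ultimately show ?thesis using holomorphic_on_compose_gen[OF _ hol] by (simp add: o_def)
  qed
  \<comment> \<open>Two slit discs cover the punctured disc. On the second, the branch
    \<open>Ln (- w) + of_real pi * \<i>\<close> replaces \<open>Ln\<close>, and periodicity of
    \<open>F\<close> makes both choices agree.\<close>
  define U1 where "U1 = ball 0 1 - (\<real>\<^sub>\<le>\<^sub>0 :: complex set)"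
  define U2 where "U2 = ball 0 1 - (\<real>\<^sub>\<ge>\<^sub>0 :: complex set)"
  have nz1: "w \<noteq> 0" "norm w < 1" if "w \<in> U1" for w using that by (auto simp: U1_def)
  have nz2: "w \<noteq> 0" "norm w < 1" if "w \<in> U2" for w using that by (auto simp: U2_def)
  have "g holomorphic_on U1"
    unfolding g_def
  proof (rule holFL)
    show "Ln holomorphic_on U1" by (intro holomorphic_intros) (auto simp: U1_def)
  qed (use nz1 Re_Ln_neg in auto)
  moreover have "g holomorphic_on U2"
  proof (rule holomorphic_transform)
    have "- w \<notin> \<real>\<^sub>\<le>\<^sub>0" if "w \<in> U2" for w
      using that by (auto simp: U2_def complex_nonpos_Reals_iff complex_nonneg_Reals_iff)
    thus "(\<lambda>w. F (L (Ln (- w) + of_real pi * \<i>))) holomorphic_on U2"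
      using nz2 by (intro holFL holomorphic_intros) auto
    show "F (L (Ln (- w) + of_real pi * \<i>)) = g w" if "w \<in> U2" for w
      using g_exp[of "Ln (- w) + of_real pi * \<i>"] nz2[OF that] by (simp add: exp_add)
  qed
  ultimately have "g holomorphic_on U1 \<union> U2"
    by (intro holomorphic_on_Un) (auto simp: U1_def U2_def intro!: open_Diff)
  moreover have "U1 \<union> U2 = ball 0 1 - {0}"
    by (auto simp: U1_def U2_def complex_nonpos_Reals_iff complex_nonneg_Reals_iff complex_eq_iff)
  ultimately have holg: "g holomorphic_on ball 0 1 - {0}" by simp
  obtain m :: nat where m: "M * real N / (2 * pi) \<le> real m" using real_arch_simple by blast
  \<comment> \<open>The power \<open>m\<close> compensates the growth of \<open>g\<close>; one
    further power forces the limit 0.\<close>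
  define G where "G = (\<lambda>w. w ^ Suc m * g w)"
  \<comment> \<open>The radius \<open>exp (- (2 * pi / real N))\<close> corresponds to height 1 in
    the upper half-plane, where the bound starts to hold.\<close>
  have G_le: "norm (G w) \<le> norm w" if w: "w \<noteq> 0" "norm w < exp (- (2 * pi / real N))" for w
  proof -
    have ln: "ln (norm w) < - (2 * pi / real N)"
      using w by (metis exp_less_cancel_iff exp_ln zero_less_norm_iff)
    hence ln0: "ln (norm w) < 0" using N by (smt (verit) divide_pos_pos of_nat_0_less_iff pi_gt_zero)
    have "1 \<le> Im (L (Ln w))" using ln w N by (simp add: ImL field_simps)
    moreover have "\<bar>Re (L (Ln w))\<bar> \<le> real N"
    proof -
      have "\<bar>Im (Ln w)\<bar> \<le> pi" using mpi_less_Im_Ln[OF w(1)] Im_Ln_le_pi[OF w(1)] by linarith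
      hence "real N * \<bar>Im (Ln w)\<bar> \<le> real N * (2 * pi)" by (intro mult_left_mono) auto
      thus ?thesis by (simp add: ReL abs_mult pos_divide_le_eq)
    qed
    ultimately have "norm (g w) \<le> exp (M * Im (L (Ln w)))" unfolding g_def by (rule bound)
    also have "M * Im (L (Ln w)) = - (M * real N / (2 * pi) * ln (norm w))" using w by (simp add: ImL)
    also have "\<dots> \<le> - (real m * ln (norm w))"
      using mult_right_mono_neg[OF m, of "ln (norm w)"] ln0 by simp
    finally have "norm (g w) \<le> exp (- (real m * ln (norm w)))" by simp
    also have "\<dots> = inverse (norm w ^ m)" using w by (simp add: exp_minus exp_of_nat_mult)
    finally have "norm w ^ m * norm (g w) \<le> 1" using w by (simp add: field_simps)
    hence "norm w * (norm w ^ m * norm (g w)) \<le> norm w * 1" by (intro mult_left_mono) auto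
    thus ?thesis by (simp add: G_def norm_mult norm_power mult_ac)
  qed
  have "G \<midarrow>0\<rightarrow> 0"
  proof (rule Lim_null_comparison)
    show "eventually (\<lambda>w. norm (G w) \<le> norm w) (at 0)"
      unfolding eventually_at using G_le by (intro exI[of _ "exp (- (2 * pi / real N))"]) auto
    show "(norm \<longlongrightarrow> 0) (at (0::complex))" by (auto intro!: tendsto_eq_intros)
  qed
  hence "not_essential G 0" by (auto simp: not_essential_def)
  moreover have "G holomorphic_on ball 0 1 - {0}"
    unfolding G_def by (intro holomorphic_intros holg)
  hence "isolated_singularity_at G 0"
    unfolding isolated_singularity_at_def by (intro exI[of _ 1]) (simp add: analytic_on_open open_delete)
  ultimately have "G meromorphic_on {0}" by (simp add: meromorphic_at_iff)
  hence mero: "(\<lambda>w. G w / w ^ Suc m) meromorphic_on {0}" by (intro meromorphic_intros)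
  show ?thesis
  proof (rule that[OF mero])
    fix \<tau> :: complex assume \<tau>: "Im \<tau> > 0"
    define \<xi> where "\<xi> = 2 * of_real pi * \<i> * \<tau> / of_nat N"
    have "Re \<xi> < 0" using \<tau> N by (simp add: \<xi>_def divide_neg_pos)
    moreover have "L \<xi> = \<tau>" using N by (simp add: L_def \<xi>_def)
    ultimately have "F \<tau> = g (exp \<xi>)" using g_exp by simp
    thus "F \<tau> = G (exp (2 * of_real pi * \<i> * \<tau> / of_nat N)) / exp (2 * of_real pi * \<i> * \<tau> / of_nat N) ^ Suc m"
      by (simp add: G_def flip: \<xi>_def)
  qed
qed

lemma holomorphic_on_eta_quotient:
  assumes "N > 0"
  shows "eta_quotient N r holomorphic_on {\<tau>. Im \<tau> > 0}"
proof -
  have pos: "Im (of_nat \<delta> * \<tau>) > 0" if "\<delta> dvd N" "Im \<tau> > 0" for \<delta> :: nat and \<tau>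
    using that assms by (auto intro: dvd_pos_nat)
  have "(\<lambda>\<tau>. \<Prod>\<delta> | \<delta> dvd N. dedekind_eta (of_nat \<delta> * \<tau>) powi r \<delta>) holomorphic_on {\<tau>. Im \<tau> > 0}"
    using pos dedekind_eta_nonzero
    by (intro holomorphic_intros open_halfspace_Im_gt) auto
  thus ?thesis by (simp add: eta_quotient_def[abs_def])
qed

text \<open>If \<open>c = 0\<close> then \<open>d\<close> is a unit; otherwise the imaginary part
  alone has absolute value at least 1. The upper bound is the triangle inequality, with constants
  absorbed by \<open>Im \<tau> \<ge> 1\<close>.\<close>

lemma norm_automorphy_factor_bounds:
  assumes "(a, b, c, d) \<in> SL2Z" "Im \<tau> \<ge> 1" "\<bar>Re \<tau>\<bar> \<le> R"
  shows "1 \<le> norm (of_int c * \<tau> + of_int d)"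
    and "norm (of_int c * \<tau> + of_int d) \<le> (\<bar>of_int c\<bar> * (R + 1) + \<bar>of_int d\<bar>) * Im \<tau>"
proof -
  show "1 \<le> norm (of_int c * \<tau> + of_int d)"
  proof (cases "c = 0")
    case True
    hence "\<bar>d\<bar> = 1" using assms(1) by (auto simp: SL2Z_def zmult_eq_1_iff)
    hence "\<bar>real_of_int d\<bar> = 1" by linarith
    thus ?thesis using True by simp
  next
    case False
    have "\<bar>real_of_int c\<bar> \<ge> 1" using False by linarith
    hence "1 * 1 \<le> \<bar>real_of_int c\<bar> * Im \<tau>"
      using assms(2) by (intro mult_mono) auto
    also have "\<dots> = \<bar>Im (of_int c * \<tau> + of_int d)\<bar>" using assms(2) by (simp add: abs_mult)
    also have "\<dots> \<le> norm (of_int c * \<tau> + of_int d)" by (rule abs_Im_le_cmod)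
    finally show ?thesis by simp
  qed
  have "norm \<tau> \<le> \<bar>Re \<tau>\<bar> + \<bar>Im \<tau>\<bar>" by (rule cmod_le)
  also have "\<dots> \<le> R * 1 + Im \<tau>" using assms by simp
  also have "\<dots> \<le> R * Im \<tau> + Im \<tau>" using assms by (intro add_right_mono mult_left_mono) auto
  finally have n: "norm \<tau> \<le> (R + 1) * Im \<tau>" by (simp add: algebra_simps)
  have "norm (of_int c * \<tau> + of_int d) \<le> \<bar>of_int c\<bar> * norm \<tau> + \<bar>of_int d\<bar> * 1"
    by (rule order_trans[OF norm_triangle_ineq]) (simp add: norm_mult)
  also have "\<dots> \<le> \<bar>of_int c\<bar> * ((R + 1) * Im \<tau>) + \<bar>of_int d\<bar> * Im \<tau>"
    using n assms by (intro add_mono mult_left_mono) auto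
  finally show "norm (of_int c * \<tau> + of_int d) \<le> (\<bar>of_int c\<bar> * (R + 1) + \<bar>of_int d\<bar>) * Im \<tau>"
    by (simp add: algebra_simps)
qed

text \<open>Near a cusp the image point can approach the real line, but
  \<open>Im \<tau> / norm J ^ 2\<close> decays at worst like 1/y when \<open>norm J\<close> is at
  most linear in y. Hence the term \<open>1 / Im \<tau>\<close> of the assumed bound costs only
  another exponential in y.\<close>

lemma norm_slash_le:
  assumes A: "A \<in> SL2Z" and "R \<ge> 0" "K \<ge> 0"
    and f: "\<And>\<tau>. Im \<tau> > 0 \<Longrightarrow> norm (f \<tau>) \<le> exp (K * (Im \<tau> + 1 / Im \<tau>))"
  obtains M where "\<And>\<tau>. Im \<tau> \<ge> 1 \<Longrightarrow> \<bar>Re \<tau>\<bar> \<le> R \<Longrightarrow> norm (slash k f A \<tau>) \<le> exp (M * Im \<tau>)"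
proof -
  obtain a b c d where A': "A = (a, b, c, d)" by (cases A)
  have SL: "(a, b, c, d) \<in> SL2Z" using A A' by simp
  define L where "L = \<bar>real_of_int c\<bar> * (R + 1) + \<bar>real_of_int d\<bar>"
  have L: "L \<ge> 0" using assms by (simp add: L_def)
  show ?thesis
  proof (rule that[of "of_int \<bar>-k\<bar> * L + K * (1 + L ^ 2)"])
    fix \<tau> assume \<tau>: "Im \<tau> \<ge> 1" "\<bar>Re \<tau>\<bar> \<le> R"
    define y where "y = Im \<tau>"
    have y: "y \<ge> 1" using \<tau> by (simp add: y_def)
    have pos: "Im \<tau> > 0" using \<tau> by simp
    define J where "J = of_int c * \<tau> + of_int d"
    have J: "1 \<le> norm J" "norm J \<le> L * y"
      using norm_automorphy_factor_bounds[OF SL \<tau>] by (simp_all add: J_def L_def y_def)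
    have "norm (J powi (- k)) \<le> exp (of_int \<bar>-k\<bar> * (L * y))"
    proof (rule norm_powi_le_exp)
      have "exp (- (L * y)) \<le> 1" using L y by simp
      thus "exp (- (L * y)) \<le> norm J" using J by linarith
      show "norm J \<le> exp (L * y)" using J(2) exp_ge_add_one_self[of "L * y"] by linarith
    qed
    moreover have "norm (f (moebius A \<tau>)) \<le> exp (K * (1 + L ^ 2) * y)"
    proof -
      define w where "w = moebius A \<tau>"
      have w: "Im w = y / norm J ^ 2" "Im w > 0"
        unfolding w_def A' J_def y_def by (rule Im_moebius[OF SL], rule Im_moebius_pos[OF SL pos])
      have "Im w \<le> y / 1"
        unfolding w(1) using y J by (intro divide_left_mono) auto
      moreover have "norm J ^ 2 \<le> (L * y) ^ 2" using J by (intro power_mono) auto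
      hence "1 / Im w \<le> L ^ 2 * y"
        using y by (simp add: w(1) pos_divide_le_eq power2_eq_square mult_ac)
      ultimately have "K * (Im w + 1 / Im w) \<le> K * ((1 + L ^ 2) * y)"
        using assms by (intro mult_left_mono) (auto simp: algebra_simps)
      hence "exp (K * (Im w + 1 / Im w)) \<le> exp (K * (1 + L ^ 2) * y)" by (simp add: mult.assoc)
      thus ?thesis using f[OF w(2)] unfolding w_def by linarith
    qed
    ultimately have "norm (slash k f A \<tau>) \<le> exp (of_int \<bar>-k\<bar> * (L * y)) * exp (K * (1 + L ^ 2) * y)"
      unfolding slash_def A' automorphy_factor.simps J_def[symmetric] norm_mult by (intro mult_mono) auto
    also have "\<dots> = exp ((of_int \<bar>-k\<bar> * L + K * (1 + L ^ 2)) * y)"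
      unfolding exp_add[symmetric] by (simp add: algebra_simps)
    finally show "norm (slash k f A \<tau>) \<le> exp ((of_int \<bar>-k\<bar> * L + K * (1 + L ^ 2)) * Im \<tau>)"
      by (simp add: y_def)
  qed
qed

text \<open>Translation by \<open>N\<close> lies in the principal congruence subgroup, which is
  normal in the full modular group, so its conjugate by the given matrix lies in
  \<open>Gamma1 N\<close>.\<close>

lemma slash_periodic:
  assumes A: "(a, b, c, d) \<in> SL2Z" and \<tau>: "Im \<tau> > 0"
    and inv: "\<And>A \<tau>. A \<in> Gamma1 N \<Longrightarrow> Im \<tau> > 0 \<Longrightarrow> f (moebius A \<tau>) = automorphy_factor A \<tau> powi k * f \<tau>"
  shows "slash k f (a, b, c, d) (\<tau> + of_nat N) = slash k f (a, b, c, d) \<tau>"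
proof -
  have det: "a * d = 1 + b * c" using A by (simp add: SL2Z_def)
  have detc: "of_int a * of_int d = (1 + of_int b * of_int c :: complex)"
    using arg_cong[OF det, of "of_int :: int \<Rightarrow> complex"] by simp
  define J where "J = of_int c * \<tau> + of_int d"
  have J: "J \<noteq> 0" unfolding J_def by (rule automorphy_factor_nonzero[OF A \<tau>])
  define J' where "J' = of_int c * (\<tau> + of_nat N) + of_int d"
  have J': "J' \<noteq> 0" unfolding J'_def using \<tau> by (intro automorphy_factor_nonzero[OF A]) simp
  define w where "w = moebius (a, b, c, d) \<tau>"
  have w: "Im w > 0" unfolding w_def by (rule Im_moebius_pos[OF A \<tau>])
  have wJ: "w * J = of_int a * \<tau> + of_int b" using J by (simp add: w_def J_def)
  text \<open>\<open>B = A T\<^sup>N A\<^bsup>-1\<^esup>\<close>\<close>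
  define B :: mat2 where "B = (1 - a * c * int N, a ^ 2 * int N, - (c ^ 2 * int N), 1 + a * c * int N)"
  have B: "B \<in> Gamma1 N"
    by (auto simp: B_def Gamma1_def SL2Z_def cong_iff_dvd_diff power2_eq_square algebra_simps)
  \<comment> \<open>The cocycle relation for the two ways of reaching the same point; translation
    itself has factor 1.\<close>
  have aut: "automorphy_factor B w * J = J'"
  proof -
    have "automorphy_factor B w * J = - (of_int c ^ 2 * of_nat N) * (w * J) + (1 + of_int a * of_int c * of_nat N) * J"
      by (simp add: B_def algebra_simps)
    also have "\<dots> = J + of_nat N * of_int c * (of_int a * of_int d - of_int b * of_int c)"
      unfolding wJ by (simp add: J_def algebra_simps power2_eq_square)
    finally show ?thesis by (simp add: detc J_def J'_def algebra_simps)
  qed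
  have autB: "automorphy_factor B w = J' / J" using aut J by (simp add: field_simps)
  have "moebius B w = ((1 - of_int a * of_int c * of_nat N) * w + of_int a ^ 2 * of_nat N) / automorphy_factor B w"
    by (simp add: B_def)
  also have "\<dots> = (((1 - of_int a * of_int c * of_nat N) * w + of_int a ^ 2 * of_nat N) * J) / (automorphy_factor B w * J)"
    using J by simp
  also have "((1 - of_int a * of_int c * of_nat N) * w + of_int a ^ 2 * of_nat N) * J =
      (1 - of_int a * of_int c * of_nat N) * (w * J) + of_int a ^ 2 * of_nat N * J"
    by (simp add: algebra_simps)
  also have "\<dots> / (automorphy_factor B w * J) = (of_int a * (\<tau> + of_nat N) + of_int b) / J'"
  proof -
    have "(1 - of_int a * of_int c * of_nat N) * (of_int a * \<tau> + of_int b) + of_int a ^ 2 * of_nat N * J =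
        of_int a * \<tau> + of_int b + of_nat N * of_int a * (of_int a * of_int d - of_int b * of_int c)"
      by (simp add: J_def algebra_simps power2_eq_square)
    thus ?thesis unfolding aut wJ by (simp add: detc algebra_simps)
  qed
  finally have "moebius (a, b, c, d) (\<tau> + of_nat N) = moebius B w" by (simp add: J'_def)
  hence "slash k f (a, b, c, d) (\<tau> + of_nat N) = J' powi (- k) * ((J' / J) powi k * f w)"
    using inv[OF B w] by (simp add: slash_def J'_def autB)
  also have "\<dots> = J powi (- k) * f w"
    using J J' by (simp add: power_int_divide_distrib power_int_minus field_simps)
  finally show ?thesis by (simp add: slash_def J_def w_def)
qed

text \<open>Eta quotients are holomorphic and satisfy the growth bound for any exponents, so the
  transformation law decides membership.\<close>

theorem eta_quotient_weakly_holomorphicI: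
  assumes N: "N > 0"
    and inv: "\<And>A \<tau>. A \<in> Gamma1 N \<Longrightarrow> Im \<tau> > 0 \<Longrightarrow>
      eta_quotient N r (moebius A \<tau>) = automorphy_factor A \<tau> powi k * eta_quotient N r \<tau>"
  shows "eta_quotient N r \<in> weakly_holomorphic_forms k N"
proof -
  note hol = holomorphic_on_eta_quotient[OF N, of r]
  have "\<exists>g. g meromorphic_on {0} \<and>
      (\<forall>\<tau>\<in>upper_half_plane. slash k (eta_quotient N r) A \<tau> = g (exp (2 * of_real pi * \<i> * \<tau> / of_nat N)))"
    if A: "A \<in> SL2Z" for A
  proof -
    obtain a b c d where A': "A = (a, b, c, d)" by (cases A)
    have SL: "(a, b, c, d) \<in> SL2Z" using A A' by simp
    have holm: "(\<lambda>\<tau>. moebius A \<tau>) holomorphic_on {\<tau>. Im \<tau> > 0}"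
      unfolding A' moebius.simps using automorphy_factor_nonzero[OF SL] by (intro holomorphic_intros) auto
    have "(\<lambda>\<tau>. eta_quotient N r (moebius A \<tau>)) holomorphic_on {\<tau>. Im \<tau> > 0}"
      using holomorphic_on_compose_gen[OF holm hol] Im_moebius_pos[OF SL] by (auto simp: A' o_def)
    hence holF: "slash k (eta_quotient N r) A holomorphic_on {\<tau>. Im \<tau> > 0}"
      unfolding slash_def[abs_def] A' automorphy_factor.simps using automorphy_factor_nonzero[OF SL]
      by (intro holomorphic_intros) auto
    obtain K where K: "K \<ge> 0" "\<And>\<tau>. Im \<tau> > 0 \<Longrightarrow> norm (eta_quotient N r \<tau>) \<le> exp (K * (Im \<tau> + 1 / Im \<tau>))"
      using norm_eta_quotient_le[OF N] by metis
    obtain M where M: "\<And>\<tau>. Im \<tau> \<ge> 1 \<Longrightarrow> \<bar>Re \<tau>\<bar> \<le> real N \<Longrightarrow> norm (slash k (eta_quotient N r) A \<tau>) \<le> exp (M * Im \<tau>)"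
      using norm_slash_le[OF A _ K(1), of "real N" "eta_quotient N r" k] K(2) by auto
    show ?thesis
      using periodic_meromorphic_at_infinity[OF N holF _ M] slash_periodic[OF SL _ inv]
      by (simp add: A' upper_half_plane_def) metis
  qed
  thus ?thesis using hol inv
    by (auto simp: weakly_holomorphic_forms_def meromorphic_at_cusps_def upper_half_plane_def)
qed

section \<open>Weights of eta quotients\<close>

lemma eta_quotient_nonzero:
  assumes "N > 0" "Im \<tau> > 0"
  shows "eta_quotient N r \<tau> \<noteq> 0"
proof -
  have "dedekind_eta (of_nat \<delta> * \<tau>) \<noteq> 0" if "\<delta> dvd N" for \<delta>
    using that assms by (intro dedekind_eta_nonzero) (auto intro: dvd_pos_nat)
  thus ?thesis using assms by (simp add: eta_quotient_def)
qed

lemma eta_quotient_add: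
  assumes "N > 0" "Im \<tau> > 0"
  shows "eta_quotient N (\<lambda>\<delta>. r \<delta> + s \<delta>) \<tau> = eta_quotient N r \<tau> * eta_quotient N s \<tau>"
  unfolding eta_quotient_def prod.distrib[symmetric]
proof (rule prod.cong)
  fix \<delta> assume "\<delta> \<in> {\<delta>. \<delta> dvd N}"
  hence "dedekind_eta (of_nat \<delta> * \<tau>) \<noteq> 0"
    using assms by (intro dedekind_eta_nonzero) (auto intro: dvd_pos_nat)
  thus "dedekind_eta (of_nat \<delta> * \<tau>) powi (r \<delta> + s \<delta>) =
      dedekind_eta (of_nat \<delta> * \<tau>) powi r \<delta> * dedekind_eta (of_nat \<delta> * \<tau>) powi s \<delta>"
    by (simp add: power_int_add)
qed simp

lemma eta_quotient_uminus: "eta_quotient N (\<lambda>\<delta>. - r \<delta>) \<tau> = inverse (eta_quotient N r \<tau>)"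
  unfolding eta_quotient_def by (simp add: power_int_minus prod_inversef[symmetric] o_def)

text \<open>Only the transformation law is recorded, since
  \<open>eta_quotient_weakly_holomorphicI\<close> supplies the rest. For \<open>N > 0\<close> this
  set is a subgroup of the integers.\<close>

definition eta_weights :: "nat \<Rightarrow> int set" where
  "eta_weights N = {k. \<exists>r. \<forall>A\<in>Gamma1 N. \<forall>\<tau>. Im \<tau> > 0 \<longrightarrow>
     eta_quotient N r (moebius A \<tau>) = automorphy_factor A \<tau> powi k * eta_quotient N r \<tau>}"

lemma eta_weightsI:
  assumes "\<And>a b c d \<tau>. (a, b, c, d) \<in> Gamma1 N \<Longrightarrow> Im \<tau> > 0 \<Longrightarrow>
    eta_quotient N r (moebius (a, b, c, d) \<tau>) = (of_int c * \<tau> + of_int d) powi k * eta_quotient N r \<tau>"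
  shows "k \<in> eta_weights N"
  unfolding eta_weights_def using assms by (fastforce simp del: moebius.simps)

lemma eta_weightsE:
  assumes "k \<in> eta_weights N"
  obtains r where "\<And>a b c d \<tau>. (a, b, c, d) \<in> Gamma1 N \<Longrightarrow> Im \<tau> > 0 \<Longrightarrow>
    eta_quotient N r (moebius (a, b, c, d) \<tau>) = (of_int c * \<tau> + of_int d) powi k * eta_quotient N r \<tau>"
  using assms unfolding eta_weights_def by (fastforce simp del: moebius.simps)

lemma Gamma1_imp_SL2Z: "A \<in> Gamma1 N \<Longrightarrow> A \<in> SL2Z"
  by (auto simp: Gamma1_def)

lemma eta_weights_zero: "0 \<in> eta_weights N"
  by (rule eta_weightsI[where r = "\<lambda>_. 0"]) (simp add: eta_quotient_def)

lemma eta_weights_add: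
  assumes "N > 0" "k \<in> eta_weights N" "l \<in> eta_weights N"
  shows "k + l \<in> eta_weights N"
proof -
  from assms(2) obtain r where r: "\<And>a b c d \<tau>. (a, b, c, d) \<in> Gamma1 N \<Longrightarrow> Im \<tau> > 0 \<Longrightarrow>
    eta_quotient N r (moebius (a, b, c, d) \<tau>) = (of_int c * \<tau> + of_int d) powi k * eta_quotient N r \<tau>"
    by (rule eta_weightsE) blast
  from assms(3) obtain s where s: "\<And>a b c d \<tau>. (a, b, c, d) \<in> Gamma1 N \<Longrightarrow> Im \<tau> > 0 \<Longrightarrow>
    eta_quotient N s (moebius (a, b, c, d) \<tau>) = (of_int c * \<tau> + of_int d) powi l * eta_quotient N s \<tau>"
    by (rule eta_weightsE) blast
  show ?thesis
  proof (rule eta_weightsI[where r = "\<lambda>\<delta>. r \<delta> + s \<delta>"])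
    fix a b c d \<tau> assume A: "(a, b, c, d) \<in> Gamma1 N" and \<tau>: "Im \<tau> > 0"
    note SL = Gamma1_imp_SL2Z[OF A]
    show "eta_quotient N (\<lambda>\<delta>. r \<delta> + s \<delta>) (moebius (a, b, c, d) \<tau>) =
        (of_int c * \<tau> + of_int d) powi (k + l) * eta_quotient N (\<lambda>\<delta>. r \<delta> + s \<delta>) \<tau>"
      using automorphy_factor_nonzero[OF SL \<tau>]
      by (simp add: eta_quotient_add[OF assms(1) \<tau>] eta_quotient_add[OF assms(1) Im_moebius_pos[OF SL \<tau>]]
          r[OF A \<tau>] s[OF A \<tau>] power_int_add del: moebius.simps)
  qed
qed

lemma eta_weights_uminus:
  assumes "k \<in> eta_weights N"
  shows "- k \<in> eta_weights N"
proof -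
  from assms obtain r where r: "\<And>a b c d \<tau>. (a, b, c, d) \<in> Gamma1 N \<Longrightarrow> Im \<tau> > 0 \<Longrightarrow>
    eta_quotient N r (moebius (a, b, c, d) \<tau>) = (of_int c * \<tau> + of_int d) powi k * eta_quotient N r \<tau>"
    by (rule eta_weightsE) blast
  show ?thesis
    by (rule eta_weightsI[where r = "\<lambda>\<delta>. - r \<delta>"])
       (simp add: eta_quotient_uminus r power_int_minus del: moebius.simps)
qed

lemma eta_quotient_support:
  assumes "N > 0" "S \<subseteq> {\<delta>. \<delta> dvd N}" "\<And>\<delta>. \<delta> \<notin> S \<Longrightarrow> r \<delta> = 0"
  shows "eta_quotient N r \<tau> = (\<Prod>\<delta>\<in>S. dedekind_eta (of_nat \<delta> * \<tau>) powi r \<delta>)"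
  unfolding eta_quotient_def using assms by (intro prod.mono_neutral_right) auto

lemma eta_weights_12:
  assumes "N > 0"
  shows "12 \<in> eta_weights N"
proof (rule eta_weightsI[where r = "\<lambda>\<delta>. if \<delta> = 1 then 24 else 0"])
  fix a b c d \<tau> assume A: "(a, b, c, d) \<in> Gamma1 N" and \<tau>: "Im \<tau> > 0"
  have "eta_quotient N (\<lambda>\<delta>. if \<delta> = 1 then 24 else 0) \<tau> = dedekind_eta \<tau> ^ 24" for \<tau>
    using eta_quotient_support[OF assms, of "{1}" "\<lambda>\<delta>. if \<delta> = 1 then 24 else 0"] by simp
  thus "eta_quotient N (\<lambda>\<delta>. if \<delta> = 1 then 24 else 0) (moebius (a, b, c, d) \<tau>) =
      (of_int c * \<tau> + of_int d) powi 12 * eta_quotient N (\<lambda>\<delta>. if \<delta> = 1 then 24 else 0) \<tau>"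
    using dedekind_eta_moebius_24[OF Gamma1_imp_SL2Z[OF A] \<tau>] by (simp del: moebius.simps)
qed

lemma Gamma1_mono:
  assumes "p dvd N" "A \<in> Gamma1 N"
  shows "A \<in> Gamma1 p"
proof -
  have "int p dvd int N" using assms by simp
  thus ?thesis using assms(2) by (auto simp: Gamma1_def intro: cong_dvd_modulus)
qed

lemma eta_weights_prime:
  assumes "N > 0" "p dvd N" "odd p" "\<not> 3 dvd p" "p > 1"
  shows "int ((p - 1) div 2) \<in> eta_weights N"
proof -
  define r where "r = (\<lambda>\<delta>. if \<delta> = 1 then int p else if \<delta> = p then -1 else 0)"
  have eq: "eta_quotient N r \<tau> = dedekind_eta \<tau> ^ p / dedekind_eta (of_nat p * \<tau>)" for \<tau>
    using assms eta_quotient_support[OF assms(1), of "{1, p}" r \<tau>]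
    by (simp add: r_def power_int_minus divide_inverse)
  show ?thesis
  proof (rule eta_weightsI[where r = r])
    fix a b c d \<tau> assume "(a, b, c, d) \<in> Gamma1 N" and \<tau>: "Im \<tau> > 0"
    hence "(a, b, c, d) \<in> Gamma1 p" using Gamma1_mono assms(2) by blast
    from eta_power_over_eta_Gamma1[OF assms(3,4) this \<tau>]
    show "eta_quotient N r (moebius (a, b, c, d) \<tau>) =
        (of_int c * \<tau> + of_int d) powi int ((p - 1) div 2) * eta_quotient N r \<tau>"
      unfolding eq power_int_of_nat .
  qed
qed

section \<open>Subgroups of the integers and greatest common divisors\<close>

lemma mult_mem_int_subgroup:
  fixes G :: "int set"
  assumes "0 \<in> G" "\<And>x y. x \<in> G \<Longrightarrow> y \<in> G \<Longrightarrow> x + y \<in> G" "\<And>x. x \<in> G \<Longrightarrow> - x \<in> G" "x \<in> G"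
  shows "n * x \<in> G"
proof (induction n rule: int_induct[of _ 0])
  case (step1 i)
  show ?case using assms(2)[OF step1(2) assms(4)] by (simp add: algebra_simps)
next
  case (step2 i)
  show ?case using assms(2)[OF step2(2) assms(3)[OF assms(4)]] by (simp add: algebra_simps)
qed (use assms in simp)

text \<open>Bezout's identity adds one generator at a time.\<close>

lemma Gcd_mem_int_subgroup:
  fixes G :: "int set" and X :: "nat set"
  assumes G: "0 \<in> G" "\<And>x y. x \<in> G \<Longrightarrow> y \<in> G \<Longrightarrow> x + y \<in> G" "\<And>x. x \<in> G \<Longrightarrow> - x \<in> G"
    and "finite X" "int ` X \<subseteq> G"
  shows "int (Gcd X) \<in> G"
  using assms(4,5)
proof (induction X rule: finite_induct)
  case (insert x X)
  obtain u v where uv: "u * int x + v * int (Gcd X) = gcd (int x) (int (Gcd X))"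
    using bezout_int by blast
  have "u * int x \<in> G" "v * int (Gcd X) \<in> G"
    using insert by (auto intro!: mult_mem_int_subgroup[OF G])
  from G(2)[OF this] show ?case unfolding uv by simp
qed (use G in simp)

section \<open>Necessary conditions on the exponents\<close>

lemma power_int_sum:
  fixes x :: real
  assumes "finite S" "x \<noteq> 0"
  shows "(\<Prod>i\<in>S. x powi r i) = x powi (\<Sum>i\<in>S. r i)"
  using assms by (induction S rule: finite_induct) (auto simp: power_int_add)

lemma eta_quotient_translation:
  assumes "N > 0" "Im \<tau> > 0"
  shows "eta_quotient N r (\<tau> + 1) = ee (of_int (\<Sum>\<delta> | \<delta> dvd N. int \<delta> * r \<delta>) / 24) * eta_quotient N r \<tau>"
proof -
  have "eta_quotient N r (\<tau> + 1) = (\<Prod>\<delta> | \<delta> dvd N. ee (of_int (int \<delta> * r \<delta>) / 24) * dedekind_eta (of_nat \<delta> * \<tau>) powi r \<delta>)"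
    unfolding eta_quotient_def
  proof (rule prod.cong)
    fix \<delta>
    have "dedekind_eta (of_nat \<delta> * (\<tau> + 1)) = ee (of_nat \<delta> / 24) * dedekind_eta (of_nat \<delta> * \<tau>)"
      using dedekind_eta_add_int[of "of_nat \<delta> * \<tau>" "int \<delta>"] by (simp add: algebra_simps)
    thus "dedekind_eta (of_nat \<delta> * (\<tau> + 1)) powi r \<delta> =
        ee (of_int (int \<delta> * r \<delta>) / 24) * dedekind_eta (of_nat \<delta> * \<tau>) powi r \<delta>"
      by (simp add: power_int_mult_distrib mult.commute flip: ee_of_int_mult)
  qed simp
  also have "\<dots> = (\<Prod>\<delta> | \<delta> dvd N. ee (of_int (int \<delta> * r \<delta>) / 24)) * eta_quotient N r \<tau>"
    by (simp only: prod.distrib eta_quotient_def)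
  also have "(\<Prod>\<delta> | \<delta> dvd N. ee (of_int (int \<delta> * r \<delta>) / 24)) = ee (\<Sum>\<delta> | \<delta> dvd N. of_int (int \<delta> * r \<delta>) / 24)"
    using assms by (intro ee_sum[symmetric]) simp
  also have "(\<Sum>\<delta> | \<delta> dvd N. of_int (int \<delta> * r \<delta>) / 24) = (of_int (\<Sum>\<delta> | \<delta> dvd N. int \<delta> * r \<delta>) / 24 :: complex)"
    by (simp add: sum_divide_distrib)
  finally show ?thesis .
qed

text \<open>If \<open>N = \<delta> * m\<close>, the point \<open>\<delta> \<tau>\<close> is moved by
  the matrix with rows (1, 0) and (m, 1), and every \<open>\<delta>\<close> yields the same
  automorphy factor.\<close>

lemma norm_eta_quotient_lower_triangular:
  assumes "N > 0" "Im \<tau> > 0"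
  shows "norm (eta_quotient N r (\<tau> / (of_nat N * \<tau> + 1))) =
    sqrt (norm (of_nat N * \<tau> + 1)) powi (\<Sum>\<delta> | \<delta> dvd N. r \<delta>) * norm (eta_quotient N r \<tau>)"
proof -
  define s where "s = sqrt (norm (of_nat N * \<tau> + 1))"
  have "of_nat N * \<tau> + 1 \<noteq> 0"
    using automorphy_factor_nonzero[of 1 0 "int N" 1 \<tau>] assms by (simp add: SL2Z_def)
  hence s: "s \<noteq> 0" by (simp add: s_def)
  have fin: "finite {\<delta>. \<delta> dvd N}" using assms by simp
  have "norm (eta_quotient N r (\<tau> / (of_nat N * \<tau> + 1))) =
      (\<Prod>\<delta> | \<delta> dvd N. s powi r \<delta> * norm (dedekind_eta (of_nat \<delta> * \<tau>) powi r \<delta>))"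
    unfolding eta_quotient_def prod_norm[symmetric]
  proof (rule prod.cong)
    fix \<delta> assume "\<delta> \<in> {\<delta>. \<delta> dvd N}"
    then obtain m where m: "N = \<delta> * m" by auto
    hence \<delta>: "\<delta> > 0" using assms by simp
    have im: "Im (of_nat \<delta> * \<tau>) > 0" using \<delta> assms by simp
    have N: "of_int (int m) * (of_nat \<delta> * \<tau>) + 1 = of_nat N * \<tau> + 1" by (simp add: m)
    have "norm (dedekind_eta (of_nat \<delta> * (\<tau> / (of_nat N * \<tau> + 1)))) = s * norm (dedekind_eta (of_nat \<delta> * \<tau>))"
      using norm_dedekind_eta_lower_triangular[OF im, of "int m"] unfolding N by (simp add: s_def)
    thus "norm (dedekind_eta (of_nat \<delta> * (\<tau> / (of_nat N * \<tau> + 1))) powi r \<delta>) =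
        s powi r \<delta> * norm (dedekind_eta (of_nat \<delta> * \<tau>) powi r \<delta>)"
      by (simp add: norm_power_int power_int_mult_distrib)
  qed simp
  also have "\<dots> = s powi (\<Sum>\<delta> | \<delta> dvd N. r \<delta>) * norm (eta_quotient N r \<tau>)"
    by (simp add: prod.distrib power_int_sum[OF fin s] eta_quotient_def prod_norm)
  finally show ?thesis unfolding s_def .
qed

text \<open>The single point \<open>\<i>\<close> suffices, as eta quotients do not vanish there:
  translation produces a root of unity that must be 1, and absolute values under a lower triangular
  matrix compare two powers of one real number.\<close>

lemma weakly_holomorphic_eta_quotient_conditions:
  assumes N: "N > 0" and f: "eta_quotient N r \<in> weakly_holomorphic_forms k N"
  shows "24 dvd (\<Sum>\<delta> | \<delta> dvd N. int \<delta> * r \<delta>)" and "(\<Sum>\<delta> | \<delta> dvd N. r \<delta>) = 2 * k"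
proof -
  have inv: "eta_quotient N r (moebius A \<tau>) = automorphy_factor A \<tau> powi k * eta_quotient N r \<tau>"
    if "A \<in> Gamma1 N" "Im \<tau> > 0" for A \<tau>
    using f that by (auto simp: weakly_holomorphic_forms_def upper_half_plane_def)
  have nz: "eta_quotient N r \<i> \<noteq> 0" using N by (intro eta_quotient_nonzero) auto
  have "(1, 1, 0, 1) \<in> Gamma1 N" by (simp add: Gamma1_def SL2Z_def)
  from inv[OF this, of \<i>] have "eta_quotient N r (\<i> + 1) = eta_quotient N r \<i>" by simp
  hence "ee (of_int (\<Sum>\<delta> | \<delta> dvd N. int \<delta> * r \<delta>) / 24) = 1"
    using eta_quotient_translation[OF N, of \<i> r] nz by simp
  then obtain n :: int where "of_int (\<Sum>\<delta> | \<delta> dvd N. int \<delta> * r \<delta>) / 24 = (of_int n :: complex)"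
    unfolding ee_eq_1_iff by blast
  hence "of_int (\<Sum>\<delta> | \<delta> dvd N. int \<delta> * r \<delta>) = (of_int (24 * n) :: complex)"
    by (simp add: field_simps)
  hence "(\<Sum>\<delta> | \<delta> dvd N. int \<delta> * r \<delta>) = 24 * n" by (simp only: of_int_eq_iff)
  thus "24 dvd (\<Sum>\<delta> | \<delta> dvd N. int \<delta> * r \<delta>)" by simp

  define s where "s = sqrt (norm (of_nat N * \<i> + 1))"
  \<comment> \<open>A base above 1 makes the integer exponent unique.\<close>
  have s: "s > 1" using N by (simp add: s_def cmod_def)
  have s2: "norm (of_nat N * \<i> + 1) = s ^ 2" by (simp add: s_def)
  have "(1, 0, int N, 1) \<in> Gamma1 N" by (simp add: Gamma1_def SL2Z_def cong_0_iff)
  from inv[OF this, of \<i>]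
  have "norm (eta_quotient N r (\<i> / (of_nat N * \<i> + 1))) = (s ^ 2) powi k * norm (eta_quotient N r \<i>)"
    by (simp add: norm_mult norm_power_int s2)
  hence "s powi (\<Sum>\<delta> | \<delta> dvd N. r \<delta>) = (s ^ 2) powi k"
    using norm_eta_quotient_lower_triangular[OF N, of \<i> r] nz by (simp flip: s_def)
  also have "\<dots> = s powi (2 * k)" using power_int_mult[of s 2 k] by simp
  finally show "(\<Sum>\<delta> | \<delta> dvd N. r \<delta>) = 2 * k"
    using s power_int_strict_increasing[of _ _ s] by (metis linorder_neqE_linordered_idom less_irrefl)
qed

lemma cong_1_if_prime_divisors_cong_1:
  fixes n g :: nat
  assumes "n > 0" "\<And>q. prime q \<Longrightarrow> q dvd n \<Longrightarrow> [q = 1] (mod g)"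
  shows "[n = 1] (mod g)"
  using assms
proof (induction n rule: prime_divisors_induct)
  case (factor q n)
  have "[q = 1] (mod g)" using factor by simp
  moreover have "[n = 1] (mod g)" using factor by (intro factor.IH) auto
  ultimately show ?case using cong_mult by fastforce
qed auto

theorem theorem4p1:
  fixes p :: "nat \<Rightarrow> nat" and t N h :: nat and k :: int
  assumes "\<And>i. i \<in> {1..t} \<Longrightarrow> prime (p i)"
    and "\<And>i. i \<in> {1..t} \<Longrightarrow> p i \<ge> 5"
    and "inj_on p {1..t}"
    and "N = (\<Prod>i = 1..t. p i)"
    and "h = Gcd (insert 24 ((\<lambda>i. p i - 1) ` {1..t})) div 2"
  shows "(\<exists>r :: nat \<Rightarrow> int. eta_quotient N r \<in> weakly_holomorphic_forms k N) \<longleftrightarrow> int h dvd k"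
proof -
  define X where "X = insert 24 ((\<lambda>i. p i - 1) ` {1..t})"
  define g where "g = Gcd X"
  have ndvd: "\<not> q dvd p i" if "i \<in> {1..t}" "prime q" "q < 5" for i q
  proof
    assume "q dvd p i"
    hence "q = p i" by (rule primes_dvd_imp_eq[OF that(2) assms(1)[OF that(1)]])
    thus False using assms(2)[OF that(1)] that(3) by simp
  qed
  have odd: "odd (p i)" and not3: "\<not> 3 dvd p i" if "i \<in> {1..t}" for i
    using ndvd[OF that, of 2] ndvd[OF that, of 3] by simp_all
  have N: "N > 0" unfolding assms(4) using assms(1) prime_gt_0_nat by (intro prod_pos) auto
  \<comment> \<open>24 and every \<open>p i - 1\<close> are even, so the halving in the definition
    of \<open>h\<close> is exact.\<close>
  have "2 dvd g" unfolding g_def using odd by (intro Gcd_greatest) (auto simp: X_def)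
  hence g: "g = 2 * h" unfolding assms(5) X_def[symmetric] g_def by simp
  show ?thesis
  proof
    assume "\<exists>r :: nat \<Rightarrow> int. eta_quotient N r \<in> weakly_holomorphic_forms k N"
    then obtain r where "eta_quotient N r \<in> weakly_holomorphic_forms k N" by blast
    note cond = weakly_holomorphic_eta_quotient_conditions[OF N this]
    have cong: "[\<delta> = 1] (mod g)" if "\<delta> dvd N" for \<delta>
    proof (rule cong_1_if_prime_divisors_cong_1)
      show "\<delta> > 0" using that N by (rule dvd_pos_nat[rotated])
      fix q assume q: "prime q" "q dvd \<delta>"
      hence "q dvd (\<Prod>i = 1..t. p i)" using that assms(4) dvd_trans by blast
      then obtain i where i: "i \<in> {1..t}" "q dvd p i" using q(1) by (auto simp: prime_dvd_prod_iff)
      hence "q = p i" using assms(1) q(1) primes_dvd_imp_eq by blast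
      moreover have "g dvd p i - 1" unfolding g_def X_def using i by (intro Gcd_dvd) auto
      ultimately show "[q = 1] (mod g)" using assms(2)[OF i(1)]
        by (simp add: cong_altdef_nat)
    qed
    \<comment> \<open>Modulo \<open>g\<close> the weighted exponent sum equals the plain one. The
      former is a multiple of 24, hence of \<open>g\<close>, and the latter is
      \<open>2 * k\<close>.\<close>
    have "int g dvd int \<delta> * r \<delta> - r \<delta>" if "\<delta> dvd N" for \<delta>
    proof -
      have "[int \<delta> = int 1] (mod int g)" using cong[OF that] by (simp only: cong_int_iff)
      hence "int g dvd (int \<delta> - 1) * r \<delta>" by (simp add: cong_iff_dvd_diff)
      thus ?thesis by (simp add: algebra_simps)
    qed
    hence "int g dvd (\<Sum>\<delta> | \<delta> dvd N. int \<delta> * r \<delta> - r \<delta>)" by (intro dvd_sum) auto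
    hence "int g dvd (\<Sum>\<delta> | \<delta> dvd N. int \<delta> * r \<delta>) - 2 * k" by (simp add: sum_subtractf cond(2))
    moreover have "g dvd 24" unfolding g_def X_def by (intro Gcd_dvd) auto
    hence "int g dvd 24" by (metis int_dvd_int_iff of_nat_numeral)
    hence "int g dvd (\<Sum>\<delta> | \<delta> dvd N. int \<delta> * r \<delta>)" using cond(1) dvd_trans by blast
    ultimately have "int g dvd 2 * k" by (metis dvd_diff_right_iff)
    thus "int h dvd k" by (simp add: g)
  next
    assume "int h dvd k"
    \<comment> \<open>Doubled weights match the generators of the gcd directly: 24 and
      \<open>p i - 1\<close> are twice the weights 12 and \<open>(p i - 1) div 2\<close>.\<close>
    let ?W = "(\<lambda>k. 2 * k) ` eta_weights N"
    have "int (Gcd X) \<in> ?W"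
    proof (rule Gcd_mem_int_subgroup)
      show "0 \<in> ?W" using eta_weights_zero by force
      show "x + y \<in> ?W" if xy: "x \<in> ?W" "y \<in> ?W" for x y
      proof -
        obtain k l where "x = 2 * k" "k \<in> eta_weights N" "y = 2 * l" "l \<in> eta_weights N" using xy by auto
        thus ?thesis using eta_weights_add[OF N, of k l] by (intro image_eqI[of _ _ "k + l"]) auto
      qed
      show "- x \<in> ?W" if x: "x \<in> ?W" for x
      proof -
        obtain k where "x = 2 * k" "k \<in> eta_weights N" using x by auto
        thus ?thesis using eta_weights_uminus[of k] by (intro image_eqI[of _ _ "- k"]) auto
      qed
      show "finite X" by (simp add: X_def)
      have "24 \<in> ?W" using eta_weights_12[OF N] by (intro image_eqI[of _ _ 12]) auto
      moreover have "int (p i - 1) \<in> ?W" if i: "i \<in> {1..t}" for i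
      proof (rule image_eqI)
        have "p i dvd N" unfolding assms(4) using i by (intro dvd_prodI) auto
        moreover have "p i > 1" using assms(2)[OF i] by simp
        ultimately show "int ((p i - 1) div 2) \<in> eta_weights N"
          using eta_weights_prime[OF N _ odd[OF i] not3[OF i]] by blast
        have "even (p i - 1)" using odd[OF i] by simp
        thus "int (p i - 1) = 2 * int ((p i - 1) div 2)" by (metis dvd_mult_div_cancel int_ops(7) of_nat_numeral)
      qed
      ultimately show "int ` X \<subseteq> ?W" by (auto simp: X_def)
    qed
    hence "int h \<in> eta_weights N" using g by (auto simp: g_def)
    moreover obtain m where "k = m * int h" using \<open>int h dvd k\<close> by (metis dvd_def mult.commute)
    ultimately have "k \<in> eta_weights N"
      using mult_mem_int_subgroup[OF eta_weights_zero eta_weights_add[OF N] eta_weights_uminus] by simp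
    then obtain r where "\<forall>A\<in>Gamma1 N. \<forall>\<tau>. Im \<tau> > 0 \<longrightarrow>
        eta_quotient N r (moebius A \<tau>) = automorphy_factor A \<tau> powi k * eta_quotient N r \<tau>"
      unfolding eta_weights_def by blast
    hence "eta_quotient N r \<in> weakly_holomorphic_forms k N"
      by (intro eta_quotient_weakly_holomorphicI[OF N]) blast
    thus "\<exists>r :: nat \<Rightarrow> int. eta_quotient N r \<in> weakly_holomorphic_forms k N" by blast
  qed
qed

end
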